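(* Let $u:P\hookrightarrow\Gamma$ be the inclusion of a subgroup, where $P$ and $\Gamma$ are finitely generated, residually finite groups, and for each $c\ge 1$ let $u_c:P/P_c\to\Gamma/\Gamma_c$ be the homomorphism induced by $u$. If $(\Gamma,P)_u$ is a Grothendieck pair, then $u_c$ is an isomorphism for all $c\ge 1$, and hence $\widehat{u}_{\mathrm{nil}}:\widehat{P}_{\mathrm{nil}}\to\widehat{\Gamma}_{\mathrm{nil}}$ is an isomorphism. In particular, if $P$ and $\Gamma$ are residually nilpotent, then they have the same nilpotent genus.
   Context: For a group $G$, the lower central series is $G_1=G$, $G_{n+1}=\langle [x,y] : x\in G_n,\ y\in G\rangle$. $G$ is residually nilpotent if $\bigcap_n G_n=1$. Two residually nilpotent groups $G,\Lambda$ have the same nilpotent genus if $G/G_c\cong\Lambda/\Lambda_c$ for all $c\ge 1$. The profinite completion $\widehat{G}$ is the inverse limit of the finite quotients of $G$; the pro-nilpotent completion $\widehat{G}_{\mathrm{nil}}$ is the inverse limit of the nilpotent quotients of $G$ (equivalently, of the quotients $G/G_c$). A homomorphism $u:P\to\Gamma$ induces homomorphisms $\widehat{u}:\widehat{P}\to\widehat{\Gamma}$ and $\widehat{u}_{\mathrm{nil}}:\widehat{P}_{\mathrm{nil}}\to\widehat{\Gamma}_{\mathrm{nil}}$. If $\Gamma$ is residually finite and $u:P\hookrightarrow\Gamma$ is the inclusion of a subgroup, then $(\Gamma,P)_u$ is a Grothendieck pair if $\widehat{u}:\widehat{P}\to\widehat{\Gamma}$ is an isomorphism but $u$ is not. 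*)

theory Defs
  imports "HOL-Algebra.Algebra"
begin

text \<open>Indexed from 1 (the first term is the whole group); the value at 0 is a dummy.\<close>

fun lower_central :: "('a, 'b) monoid_scheme \<Rightarrow> nat \<Rightarrow> 'a set" where
  "lower_central G 0 = carrier G"
| "lower_central G (Suc 0) = carrier G"
| "lower_central G (Suc (Suc n)) =
     generate G {x \<otimes>\<^bsub>G\<^esub> y \<otimes>\<^bsub>G\<^esub> inv\<^bsub>G\<^esub> x \<otimes>\<^bsub>G\<^esub> inv\<^bsub>G\<^esub> y | x y.
                   x \<in> lower_central G (Suc n) \<and> y \<in> carrier G}"

definition nilpotent_group :: "('a, 'b) monoid_scheme \<Rightarrow> bool" where
  "nilpotent_group G \<longleftrightarrow> group G \<and> (\<exists>n\<ge>1. lower_central G n = {\<one>\<^bsub>G\<^esub>})"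

definition residually_nilpotent :: "('a, 'b) monoid_scheme \<Rightarrow> bool" where
  "residually_nilpotent G \<longleftrightarrow> group G \<and> (\<Inter>n\<in>{1..}. lower_central G n) = {\<one>\<^bsub>G\<^esub>}"

definition finitely_generated_group :: "('a, 'b) monoid_scheme \<Rightarrow> bool" where
  "finitely_generated_group G \<longleftrightarrow>
     group G \<and> (\<exists>S. finite S \<and> S \<subseteq> carrier G \<and> generate G S = carrier G)"

definition residually_finite :: "('a, 'b) monoid_scheme \<Rightarrow> bool" where
  "residually_finite G \<longleftrightarrow>
     group G \<and>
     (\<forall>g\<in>carrier G. g \<noteq> \<one>\<^bsub>G\<^esub> \<longrightarrow>
        (\<exists>N. N \<lhd> G \<and> finite (carrier (G Mod N)) \<and> g \<notin> N))"

text \<open>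
  The map \<open>G Mod N \<rightarrow> H Mod M\<close> induced by a homomorphism \<open>u\<close> from \<open>G\<close> to \<open>H\<close> with
  \<open>u ` N \<subseteq> M\<close>: the coset of \<open>g\<close> is sent to the coset of \<open>u g\<close>
  (see \<open>quot_map_coset\<close> below).
\<close>

definition quot_map ::
    "('c, 'd) monoid_scheme \<Rightarrow> 'c set \<Rightarrow> ('a \<Rightarrow> 'c) \<Rightarrow> 'a set \<Rightarrow> 'c set" where
  "quot_map H M u = (\<lambda>C. M <#>\<^bsub>H\<^esub> (u ` C))"

text \<open>
  The inverse limit of the quotients \<open>G Mod N\<close>, for \<open>N\<close> in a family \<open>\<N>\<close> of normal
  subgroups, along the canonical projections \<open>G Mod M \<rightarrow> G Mod N\<close> for \<open>M \<subseteq> N\<close>.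
\<close>

definition completion ::
    "('a, 'b) monoid_scheme \<Rightarrow> 'a set set \<Rightarrow> ('a set \<Rightarrow> 'a set) monoid" where
  "completion G \<N> = (product_group \<N> (\<lambda>N. G Mod N))
     \<lparr>carrier := {x \<in> carrier (product_group \<N> (\<lambda>N. G Mod N)).
        \<forall>M\<in>\<N>. \<forall>N\<in>\<N>. M \<subseteq> N \<longrightarrow> quot_map G N (\<lambda>g. g) (x M) = x N}\<rparr>"

text \<open>
  The map of completions induced by \<open>u\<close>, where \<open>\<M>\<close> is the family of normal subgroups
  of \<open>H\<close>: its component at \<open>M\<close> is the component of the argument at the preimage of \<open>M\<close>,
  followed by the map induced by \<open>u\<close> from \<open>G\<close> modulo that preimage to \<open>H Mod M\<close>.
\<close>

definition completion_map ::
    "('a, 'b) monoid_scheme \<Rightarrow> ('c, 'd) monoid_scheme \<Rightarrow> 'c set set \<Rightarrow> ('a \<Rightarrow> 'c)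
      \<Rightarrow> ('a set \<Rightarrow> 'a set) \<Rightarrow> ('c set \<Rightarrow> 'c set)" where
  "completion_map G H \<M> u =
     (\<lambda>x. \<lambda>M\<in>\<M>. quot_map H M u (x {g \<in> carrier G. u g \<in> M}))"

definition finite_quotient_kernels :: "('a, 'b) monoid_scheme \<Rightarrow> 'a set set" where
  "finite_quotient_kernels G = {N. N \<lhd> G \<and> finite (carrier (G Mod N))}"

definition nilpotent_quotient_kernels :: "('a, 'b) monoid_scheme \<Rightarrow> 'a set set" where
  "nilpotent_quotient_kernels G = {N. N \<lhd> G \<and> nilpotent_group (G Mod N)}"

definition profinite_completion ::
    "('a, 'b) monoid_scheme \<Rightarrow> ('a set \<Rightarrow> 'a set) monoid" where
  "profinite_completion G = completion G (finite_quotient_kernels G)"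

definition profinite_map ::
    "('a, 'b) monoid_scheme \<Rightarrow> ('c, 'd) monoid_scheme \<Rightarrow> ('a \<Rightarrow> 'c)
      \<Rightarrow> ('a set \<Rightarrow> 'a set) \<Rightarrow> ('c set \<Rightarrow> 'c set)" where
  "profinite_map G H u = completion_map G H (finite_quotient_kernels H) u"

definition pronilpotent_completion ::
    "('a, 'b) monoid_scheme \<Rightarrow> ('a set \<Rightarrow> 'a set) monoid" where
  "pronilpotent_completion G = completion G (nilpotent_quotient_kernels G)"

definition pronilpotent_map ::
    "('a, 'b) monoid_scheme \<Rightarrow> ('c, 'd) monoid_scheme \<Rightarrow> ('a \<Rightarrow> 'c)
      \<Rightarrow> ('a set \<Rightarrow> 'a set) \<Rightarrow> ('c set \<Rightarrow> 'c set)" where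
  "pronilpotent_map G H u = completion_map G H (nilpotent_quotient_kernels H) u"

text \<open>
  No topology is recorded on the completions. For \<open>profinite_map\<close> nothing is lost: it is
  continuous from a compact to a Hausdorff group, so an abstract isomorphism of this form
  is a homeomorphism.
\<close>

definition grothendieck_pair :: "('a, 'b) monoid_scheme \<Rightarrow> 'a set \<Rightarrow> bool" where
  "grothendieck_pair \<Gamma> P \<longleftrightarrow>
     residually_finite \<Gamma> \<and> subgroup P \<Gamma> \<and>
     profinite_map (\<Gamma>\<lparr>carrier := P\<rparr>) \<Gamma> (\<lambda>x. x)
       \<in> iso (profinite_completion (\<Gamma>\<lparr>carrier := P\<rparr>)) (profinite_completion \<Gamma>) \<and>
     (\<lambda>x. x) \<notin> iso (\<Gamma>\<lparr>carrier := P\<rparr>) \<Gamma>"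

definition same_nilpotent_genus ::
    "('a, 'b) monoid_scheme \<Rightarrow> ('c, 'd) monoid_scheme \<Rightarrow> bool" where
  "same_nilpotent_genus G H \<longleftrightarrow>
     residually_nilpotent G \<and> residually_nilpotent H \<and>
     (\<forall>c\<ge>1. G Mod lower_central G c \<cong> H Mod lower_central H c)"

lemma (in group) lower_central_subgroup: "subgroup (lower_central G n) G"
proof -
  have "subgroup (lower_central G (Suc m)) G" for m
  proof (induction m)
    case 0
    show ?case by (simp add: subgroup_self)
  next
    case (Suc m)
    then have "lower_central G (Suc m) \<subseteq> carrier G"
      by (rule subgroup.subset)
    then show ?case
      by (auto intro!: generate_is_subgroup)
  qed
  then show ?thesis
    by (cases n) (auto simp: subgroup_self)
qed

lemma (in group_hom) lower_central_image: "h ` lower_central G n \<subseteq> lower_central H n"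
proof -
  have "h ` lower_central G (Suc m) \<subseteq> lower_central H (Suc m)" for m
  proof (induction m)
    case 0
    show ?case by auto
  next
    case (Suc m)
    let ?S = "{x \<otimes>\<^bsub>G\<^esub> y \<otimes>\<^bsub>G\<^esub> inv\<^bsub>G\<^esub> x \<otimes>\<^bsub>G\<^esub> inv\<^bsub>G\<^esub> y | x y.
                x \<in> lower_central G (Suc m) \<and> y \<in> carrier G}"
    let ?T = "{x \<otimes>\<^bsub>H\<^esub> y \<otimes>\<^bsub>H\<^esub> inv\<^bsub>H\<^esub> x \<otimes>\<^bsub>H\<^esub> inv\<^bsub>H\<^esub> y | x y.
                x \<in> lower_central H (Suc m) \<and> y \<in> carrier H}"
    have sub: "lower_central G (Suc m) \<subseteq> carrier G"
      using G.lower_central_subgroup by (rule subgroup.subset)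
    then have S: "?S \<subseteq> carrier G"
      by auto
    have "h ` ?S \<subseteq> ?T"
    proof (rule image_subsetI)
      fix z assume "z \<in> ?S"
      then obtain x y where *: "x \<in> lower_central G (Suc m)" "y \<in> carrier G"
        and z: "z = x \<otimes>\<^bsub>G\<^esub> y \<otimes>\<^bsub>G\<^esub> inv\<^bsub>G\<^esub> x \<otimes>\<^bsub>G\<^esub> inv\<^bsub>G\<^esub> y"
        by blast
      have x: "x \<in> carrier G"
        using * sub by blast
      have "h x \<in> lower_central H (Suc m)" "h y \<in> carrier H"
        using Suc * by auto
      moreover have "h z = h x \<otimes>\<^bsub>H\<^esub> h y \<otimes>\<^bsub>H\<^esub> inv\<^bsub>H\<^esub> h x \<otimes>\<^bsub>H\<^esub> inv\<^bsub>H\<^esub> h y"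
        using x * by (simp add: z)
      ultimately show "h z \<in> ?T"
        by blast
    qed
    then have "generate H (h ` ?S) \<subseteq> generate H ?T"
      by (rule H.mono_generate)
    then show ?case
      using generate_img[OF S] by simp
  qed
  then show ?thesis
    by (cases n) auto
qed

lemma (in group) lower_central_normal: "lower_central G n \<lhd> G"
proof (rule normal_invI[OF lower_central_subgroup])
  fix g x assume g: "g \<in> carrier G" and x: "x \<in> lower_central G n"
  have "(\<lambda>x. g \<otimes> x \<otimes> inv g) \<in> hom G G"
    using g by (auto intro!: homI simp: m_assoc inv_solve_left)
  then interpret conj: group_hom G G "\<lambda>x. g \<otimes> x \<otimes> inv g"
    by unfold_locales
  show "g \<otimes> x \<otimes> inv g \<in> lower_central G n"
    using conj.lower_central_image[of n] x by blast
qed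

lemma (in group_hom) quot_map_coset:
  assumes N: "N \<lhd> G" and M: "M \<lhd> H" and sub: "h ` N \<subseteq> M" and g: "g \<in> carrier G"
  shows "quot_map H M h (N #>\<^bsub>G\<^esub> g) = M #>\<^bsub>H\<^esub> h g"
proof -
  interpret N: normal N G by fact
  interpret M: normal M H by fact
  have "m \<otimes>\<^bsub>H\<^esub> h (n \<otimes>\<^bsub>G\<^esub> g) \<in> M #>\<^bsub>H\<^esub> h g" if "m \<in> M" "n \<in> N" for m n
  proof -
    have "m \<otimes>\<^bsub>H\<^esub> h (n \<otimes>\<^bsub>G\<^esub> g) = (m \<otimes>\<^bsub>H\<^esub> h n) \<otimes>\<^bsub>H\<^esub> h g"
      using that g by (simp add: H.m_assoc N.mem_carrier M.mem_carrier)
    moreover have "m \<otimes>\<^bsub>H\<^esub> h n \<in> M"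
      using that sub by blast
    ultimately show ?thesis
      unfolding r_coset_def by blast
  qed
  then have "quot_map H M h (N #>\<^bsub>G\<^esub> g) \<subseteq> M #>\<^bsub>H\<^esub> h g"
    by (auto simp: quot_map_def set_mult_def r_coset_def[of G])
  moreover have "M #>\<^bsub>H\<^esub> h g \<subseteq> quot_map H M h (N #>\<^bsub>G\<^esub> g)"
  proof -
    have "h g \<in> h ` (N #>\<^bsub>G\<^esub> g)"
      using G.rcos_self[OF g N.subgroup_axioms] by blast
    then show ?thesis
      unfolding quot_map_def set_mult_def r_coset_def[of H] by blast
  qed
  ultimately show ?thesis
    by blast
qed

lemma (in group_hom) quot_map_hom:
  assumes N: "N \<lhd> G" and M: "M \<lhd> H" and sub: "h ` N \<subseteq> M"
  shows "quot_map H M h \<in> hom (G Mod N) (H Mod M)"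
proof (rule homI)
  fix A assume "A \<in> carrier (G Mod N)"
  then obtain a where "a \<in> carrier G" "A = N #>\<^bsub>G\<^esub> a"
    by (auto simp: carrier_FactGroup)
  then show "quot_map H M h A \<in> carrier (H Mod M)"
    using quot_map_coset[OF assms] by (auto simp: carrier_FactGroup)
next
  fix A B assume "A \<in> carrier (G Mod N)" "B \<in> carrier (G Mod N)"
  then obtain a b where "a \<in> carrier G" "A = N #>\<^bsub>G\<^esub> a" "b \<in> carrier G" "B = N #>\<^bsub>G\<^esub> b"
    by (auto simp: carrier_FactGroup)
  then show "quot_map H M h (A \<otimes>\<^bsub>G Mod N\<^esub> B)
      = quot_map H M h A \<otimes>\<^bsub>H Mod M\<^esub> quot_map H M h B"
    using quot_map_coset[OF assms] by (simp add: normal.rcos_sum[OF N] normal.rcos_sum[OF M])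
qed

lemma (in group_hom) quot_map_lower_central_hom:
  "quot_map H (lower_central H c) h \<in> hom (G Mod lower_central G c) (H Mod lower_central H c)"
  by (intro quot_map_hom G.lower_central_normal H.lower_central_normal lower_central_image)

lemma (in group) quot_map_id_hom:
  assumes "M \<lhd> G" "N \<lhd> G" "M \<subseteq> N"
  shows "quot_map G N (\<lambda>g. g) \<in> hom (G Mod M) (G Mod N)"
proof -
  interpret id: group_hom G G "\<lambda>g. g"
    by unfold_locales (auto simp: hom_def)
  show ?thesis
    using assms by (intro id.quot_map_hom) auto
qed

lemma (in group) completion_group:
  assumes "\<And>N. N \<in> \<N> \<Longrightarrow> N \<lhd> G"
  shows "group (completion G \<N>)"
proof -
  let ?Q = "\<lambda>N. G Mod N"
  let ?C = "{x \<in> carrier (product_group \<N> ?Q).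
        \<forall>M\<in>\<N>. \<forall>N\<in>\<N>. M \<subseteq> N \<longrightarrow> quot_map G N (\<lambda>g. g) (x M) = x N}"
  have Q: "group (?Q N)" if "N \<in> \<N>" for N
    using assms[OF that] by (rule normal.factorgroup_is_group)
  then interpret product: group "product_group \<N> ?Q"
    by simp
  have hom: "group_hom (?Q M) (?Q N) (quot_map G N (\<lambda>g. g))"
    if "M \<in> \<N>" "N \<in> \<N>" "M \<subseteq> N" for M N
    using that Q assms by (simp add: group_hom_def group_hom_axioms_def quot_map_id_hom)
  have "subgroup ?C (product_group \<N> ?Q)"
  proof (rule product.subgroupI)
    show "?C \<subseteq> carrier (product_group \<N> ?Q)"
      by blast
    have "\<one>\<^bsub>?Q N\<^esub> \<in> carrier (?Q N)" if "N \<in> \<N>" for N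
      using Q[OF that] by (intro monoid.one_closed group.is_monoid)
    moreover have "quot_map G N (\<lambda>g. g) \<one>\<^bsub>?Q M\<^esub> = \<one>\<^bsub>?Q N\<^esub>"
      if "M \<in> \<N>" "N \<in> \<N>" "M \<subseteq> N" for M N
      using group_hom.hom_one[OF hom] that by blast
    ultimately have "\<one>\<^bsub>product_group \<N> ?Q\<^esub> \<in> ?C"
      by (simp del: one_FactGroup)
    then show "?C \<noteq> {}"
      by blast
  next
    fix x assume x: "x \<in> ?C"
    then have "inv\<^bsub>product_group \<N> ?Q\<^esub> x = (\<lambda>N\<in>\<N>. inv\<^bsub>?Q N\<^esub> x N)"
      using Q by (intro inv_product_group) auto
    moreover have "x N \<in> carrier (?Q N)" if "N \<in> \<N>" for N
      using x that by auto
    ultimately show "inv\<^bsub>product_group \<N> ?Q\<^esub> x \<in> ?C"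
      using x Q group_hom.hom_inv[OF hom] by (auto intro: group.inv_closed)
  next
    fix x y assume xy: "x \<in> ?C" "y \<in> ?C"
    then have "x N \<in> carrier (?Q N)" "y N \<in> carrier (?Q N)" if "N \<in> \<N>" for N
      using that by auto
    then show "x \<otimes>\<^bsub>product_group \<N> ?Q\<^esub> y \<in> ?C"
      using xy monoid.m_closed[OF group.is_monoid[OF Q]] group_hom.hom_mult[OF hom]
      by (auto simp del: mult_FactGroup)
  qed
  then show ?thesis
    unfolding completion_def by (rule product.subgroup_imp_group)
qed

lemma (in group_hom) preimage_normal:
  assumes M: "M \<lhd> H"
  shows "{g \<in> carrier G. h g \<in> M} \<lhd> G"
proof -
  interpret M: normal M H by fact
  have "\<one>\<^bsub>G\<^esub> \<in> {g \<in> carrier G. h g \<in> M}"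
    by simp
  then have "subgroup {g \<in> carrier G. h g \<in> M} G"
    by (intro G.subgroupI) (blast, blast, simp_all)
  then show ?thesis
    by (rule G.normal_invI) (simp add: M.inv_op_closed2)
qed

lemma (in group_hom) quot_map_preimage_inj:
  assumes M: "M \<lhd> H"
  shows "inj_on (quot_map H M h) (carrier (G Mod {g \<in> carrier G. h g \<in> M}))"
proof -
  define N where "N = {g \<in> carrier G. h g \<in> M}"
  have sub: "h ` N \<subseteq> M" and N_I: "\<And>g. g \<in> carrier G \<Longrightarrow> h g \<in> M \<Longrightarrow> g \<in> N"
    by (auto simp: N_def)
  interpret M: normal M H by fact
  interpret N: normal N G unfolding N_def by (rule preimage_normal[OF M])
  have "inj_on (quot_map H M h) (carrier (G Mod N))"
  proof (rule inj_onI)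
    fix A B assume "A \<in> carrier (G Mod N)" "B \<in> carrier (G Mod N)"
      and eq: "quot_map H M h A = quot_map H M h B"
    then obtain a b where ab: "a \<in> carrier G" "A = N #>\<^bsub>G\<^esub> a" "b \<in> carrier G" "B = N #>\<^bsub>G\<^esub> b"
      by (auto simp: carrier_FactGroup)
    then have "M #>\<^bsub>H\<^esub> h a = M #>\<^bsub>H\<^esub> h b"
      using eq quot_map_coset[OF N.normal_axioms M sub] by simp
    then have "h a \<in> M #>\<^bsub>H\<^esub> h b"
      using H.rcos_self[OF _ M.subgroup_axioms, of "h a"] ab by simp
    then obtain m where m: "m \<in> M" "h a = m \<otimes>\<^bsub>H\<^esub> h b"
      by (auto simp: r_coset_def)
    then have "h (a \<otimes>\<^bsub>G\<^esub> inv\<^bsub>G\<^esub> b) = m"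
      using ab by (simp add: H.m_assoc M.mem_carrier)
    then have "a \<otimes>\<^bsub>G\<^esub> inv\<^bsub>G\<^esub> b \<in> N"
      using ab m by (intro N_I) simp_all
    moreover have "a = (a \<otimes>\<^bsub>G\<^esub> inv\<^bsub>G\<^esub> b) \<otimes>\<^bsub>G\<^esub> b"
      using ab by (simp add: G.m_assoc)
    ultimately have "a \<in> N #>\<^bsub>G\<^esub> b"
      unfolding r_coset_def by blast
    then show "A = B"
      using ab G.repr_independence[OF _ _ N.subgroup_axioms] by simp
  qed
  then show ?thesis
    unfolding N_def .
qed

lemma (in group_hom) nilpotent_group_inj:
  assumes "inj_on h (carrier G)" "nilpotent_group H"
  shows "nilpotent_group G"
proof -
  obtain n where n: "n \<ge> 1" "lower_central H n = {\<one>\<^bsub>H\<^esub>}"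
    using assms by (auto simp: nilpotent_group_def)
  interpret L: subgroup "lower_central G n" G
    by (rule G.lower_central_subgroup)
  have "lower_central G n \<subseteq> {\<one>\<^bsub>G\<^esub>}"
  proof
    fix x assume x: "x \<in> lower_central G n"
    then have "h x = \<one>\<^bsub>H\<^esub>"
      using lower_central_image[of n] n by blast
    then show "x \<in> {\<one>\<^bsub>G\<^esub>}"
      using assms(1) x by (auto dest!: inj_onD[of h _ x "\<one>\<^bsub>G\<^esub>"])
  qed
  then have "lower_central G n = {\<one>\<^bsub>G\<^esub>}"
    by auto
  then show ?thesis
    using n G.group_axioms by (auto simp: nilpotent_group_def)
qed

lemma (in group_hom) quot_map_preimage_group_hom:
  assumes M: "M \<lhd> H"
  shows "group_hom (G Mod {g \<in> carrier G. h g \<in> M}) (H Mod M) (quot_map H M h)"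
  by (intro group_hom.intro group_hom_axioms.intro normal.factorgroup_is_group
      quot_map_hom preimage_normal M) blast

lemma (in group_hom) preimage_finite_quotient_kernels:
  assumes "M \<in> finite_quotient_kernels H"
  shows "{g \<in> carrier G. h g \<in> M} \<in> finite_quotient_kernels G"
proof -
  have M: "M \<lhd> H" "finite (carrier (H Mod M))"
    using assms by (auto simp: finite_quotient_kernels_def)
  interpret q: group_hom "G Mod {g \<in> carrier G. h g \<in> M}" "H Mod M" "quot_map H M h"
    by (rule quot_map_preimage_group_hom[OF M(1)])
  have "finite (carrier (G Mod {g \<in> carrier G. h g \<in> M}))"
    by (rule inj_on_finite[OF quot_map_preimage_inj[OF M(1)] _ M(2)]) auto
  then show ?thesis
    using preimage_normal[OF M(1)] by (simp add: finite_quotient_kernels_def)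
qed

lemma (in group_hom) preimage_nilpotent_quotient_kernels:
  assumes "M \<in> nilpotent_quotient_kernels H"
  shows "{g \<in> carrier G. h g \<in> M} \<in> nilpotent_quotient_kernels G"
proof -
  have M: "M \<lhd> H" "nilpotent_group (H Mod M)"
    using assms by (auto simp: nilpotent_quotient_kernels_def)
  have "nilpotent_group (G Mod {g \<in> carrier G. h g \<in> M})"
    using quot_map_preimage_inj[OF M(1)] M(2)
    by (rule group_hom.nilpotent_group_inj[OF quot_map_preimage_group_hom[OF M(1)]])
  then show ?thesis
    using preimage_normal[OF M(1)] by (simp add: nilpotent_quotient_kernels_def)
qed

lemma (in group_hom) completion_map_hom:
  assumes \<N>: "\<And>N. N \<in> \<N> \<Longrightarrow> N \<lhd> G" and \<M>: "\<And>M. M \<in> \<M> \<Longrightarrow> M \<lhd> H"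
    and preimage: "\<And>M. M \<in> \<M> \<Longrightarrow> {g \<in> carrier G. h g \<in> M} \<in> \<N>"
  shows "completion_map G H \<M> h \<in> hom (completion G \<N>) (completion H \<M>)"
proof (rule homI)
  let ?p = "\<lambda>M. {g \<in> carrier G. h g \<in> M}"
  have q: "group_hom (G Mod ?p M) (H Mod M) (quot_map H M h)" if "M \<in> \<M>" for M
    by (rule quot_map_preimage_group_hom[OF \<M>[OF that]])
  have idG: "group_hom G G (\<lambda>g. g)"
    by (intro group_hom.intro group_hom_axioms.intro G.group_axioms) (simp add: hom_def)
  have idH: "group_hom H H (\<lambda>g. g)"
    by (intro group_hom.intro group_hom_axioms.intro H.group_axioms) (simp add: hom_def)
  {
    fix x assume x: "x \<in> carrier (completion G \<N>)"
    have xN: "x N \<in> carrier (G Mod N)" if "N \<in> \<N>" for N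
      using x that by (auto simp: completion_def)
    have compat: "quot_map H M' (\<lambda>g. g) (quot_map H M h (x (?p M))) = quot_map H M' h (x (?p M'))"
      if M: "M \<in> \<M>" "M' \<in> \<M>" "M \<subseteq> M'" for M M'
    proof -
      have norm: "?p M \<lhd> G" "?p M' \<lhd> G"
        using that preimage \<N> by auto
      obtain g where g: "g \<in> carrier G" "x (?p M) = ?p M #>\<^bsub>G\<^esub> g"
        using xN[OF preimage[OF M(1)]] by (auto simp: carrier_FactGroup)
      have "x (?p M') = quot_map G (?p M') (\<lambda>g. g) (x (?p M))"
      proof -
        have "\<forall>K\<in>\<N>. \<forall>L\<in>\<N>. K \<subseteq> L \<longrightarrow> quot_map G L (\<lambda>g. g) (x K) = x L"
          using x by (simp add: completion_def)
        moreover have "?p M \<subseteq> ?p M'"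
          using M(3) by blast
        ultimately show ?thesis
          using preimage[OF M(1)] preimage[OF M(2)] by simp
      qed
      also have "\<dots> = ?p M' #>\<^bsub>G\<^esub> g"
        unfolding g(2) using M by (intro group_hom.quot_map_coset[OF idG] norm g(1)) auto
      finally have "quot_map H M' h (x (?p M')) = M' #>\<^bsub>H\<^esub> h g"
        using quot_map_coset[OF norm(2) \<M>[OF M(2)] _ g(1)] by auto
      moreover have "quot_map H M h (x (?p M)) = M #>\<^bsub>H\<^esub> h g"
        unfolding g(2) by (rule quot_map_coset[OF norm(1) \<M>[OF M(1)] _ g(1)]) auto
      moreover have "quot_map H M' (\<lambda>g. g) (M #>\<^bsub>H\<^esub> h g) = M' #>\<^bsub>H\<^esub> h g"
        using M g by (intro group_hom.quot_map_coset[OF idH] \<M>) auto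
      ultimately show ?thesis
        by simp
    qed
    show "completion_map G H \<M> h x \<in> carrier (completion H \<M>)"
      using compat xN preimage group_hom.hom_closed[OF q]
      by (auto simp: completion_def completion_map_def)
  }
  fix x y assume xy: "x \<in> carrier (completion G \<N>)" "y \<in> carrier (completion G \<N>)"
  then have "x N \<in> carrier (G Mod N)" "y N \<in> carrier (G Mod N)" if "N \<in> \<N>" for N
    using that by (auto simp: completion_def)
  then show "completion_map G H \<M> h (x \<otimes>\<^bsub>completion G \<N>\<^esub> y)
      = completion_map G H \<M> h x \<otimes>\<^bsub>completion H \<M>\<^esub> completion_map G H \<M> h y"
    using preimage group_hom.hom_mult[OF q]
    by (auto simp: completion_def completion_map_def simp del: mult_FactGroup intro!: restrict_ext)
qed

lemma (in group_hom) profinite_map_hom: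
  "profinite_map G H h \<in> hom (profinite_completion G) (profinite_completion H)"
  unfolding profinite_map_def profinite_completion_def
  by (rule completion_map_hom) (auto simp: preimage_finite_quotient_kernels, auto simp: finite_quotient_kernels_def)

lemma (in group_hom) pronilpotent_map_hom:
  "pronilpotent_map G H h \<in> hom (pronilpotent_completion G) (pronilpotent_completion H)"
  unfolding pronilpotent_map_def pronilpotent_completion_def
  by (rule completion_map_hom)
    (auto simp: preimage_nilpotent_quotient_kernels, auto simp: nilpotent_quotient_kernels_def)

end

theory Submission
  imports Defs "HOL-Analysis.Function_Topology"
begin

text \<open>
  Surjectivity of \<open>u\<close> on profinite completions says that \<open>P\<close> maps onto every finite quotient
  of \<open>\<Gamma>\<close>; injectivity says, by compactness, that every finite-index normal subgroup of \<open>P\<close>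
  contains the trace \<open>M \<inter> P\<close> of one of \<open>\<Gamma>\<close>. Both are combined with the residual finiteness of
  finitely generated nilpotent groups.

  Surjectivity of \<open>u\<^sub>c\<close>, by induction on \<open>c\<close>: if \<open>P \<Gamma>\<^sub>c = \<Gamma>\<close>, then \<open>P \<Gamma>\<^bsub>c+1\<^esub>\<close> is normal in \<open>\<Gamma>\<close>, because
  \<open>\<Gamma>\<^sub>c\<close> is central modulo \<open>\<Gamma>\<^bsub>c+1\<^esub>\<close>. If it were proper, some proper finite-index normal subgroup of \<open>\<Gamma>\<close>
  would contain it, hence contain \<open>P\<close>. Injectivity of \<open>u\<^sub>c\<close>: an element \<open>g\<close> of \<open>P\<close> outside \<open>P\<^sub>c\<close> lies
  outside some finite-index \<open>N \<supseteq> P\<^sub>c\<close> of \<open>P\<close>, and \<open>N \<supseteq> M \<inter> P\<close> for some \<open>M\<close>; as \<open>P\<close> maps onto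
  \<open>\<Gamma>/M\<close>, we have \<open>\<Gamma>\<^sub>c \<subseteq> P\<^sub>c M\<close>, so \<open>g \<notin> \<Gamma>\<^sub>c\<close>.
\<close>

section \<open>Residual finiteness of finitely generated nilpotent groups\<close>

definition centre :: "('a, 'b) monoid_scheme \<Rightarrow> 'a set" where
  "centre G = {z \<in> carrier G. \<forall>y\<in>carrier G. z \<otimes>\<^bsub>G\<^esub> y = y \<otimes>\<^bsub>G\<^esub> z}"

text \<open>Stated through commutators, not as preimages of centres of quotients, so that no term
  has to be normal before the next one is formed. The index starts at 0 with the trivial subgroup,
  whereas \<open>lower_central\<close> properly starts at 1.\<close>

fun upper_central :: "('a, 'b) monoid_scheme \<Rightarrow> nat \<Rightarrow> 'a set" where
  "upper_central G 0 = {\<one>\<^bsub>G\<^esub>}"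
| "upper_central G (Suc n) = {x \<in> carrier G. \<forall>y\<in>carrier G.
     x \<otimes>\<^bsub>G\<^esub> y \<otimes>\<^bsub>G\<^esub> inv\<^bsub>G\<^esub> x \<otimes>\<^bsub>G\<^esub> inv\<^bsub>G\<^esub> y \<in> upper_central G n}"

lemma (in group) comm_eq_one_iff:
  assumes "x \<in> carrier G" "y \<in> carrier G"
  shows "x \<otimes> y \<otimes> inv x \<otimes> inv y = \<one> \<longleftrightarrow> x \<otimes> y = y \<otimes> x"
proof -
  have "x \<otimes> y \<otimes> inv x \<otimes> inv y = (x \<otimes> y) \<otimes> inv (y \<otimes> x)"
    using assms by (simp add: inv_mult_group m_assoc)
  then show ?thesis
    using assms by (metis inv_closed inv_equality inv_inv m_closed r_inv)
qed

text \<open>Lets centrality be tested on generators: a centralizer containing a generating set is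
  the whole group.\<close>

lemma (in group) centralizer_subgroup:
  assumes x: "x \<in> carrier G"
  shows "subgroup {y \<in> carrier G. x \<otimes> y = y \<otimes> x} G"
proof (rule subgroupI)
  show "{y \<in> carrier G. x \<otimes> y = y \<otimes> x} \<noteq> {}"
    using x by (auto intro!: exI[of _ \<one>])
  fix a assume a: "a \<in> {y \<in> carrier G. x \<otimes> y = y \<otimes> x}"
  then have aC: "a \<in> carrier G"
    by simp
  with a have "x \<otimes> inv a = inv a \<otimes> (a \<otimes> x) \<otimes> inv a"
    using x by (simp add: m_assoc[symmetric])
  also have "\<dots> = inv a \<otimes> (x \<otimes> a) \<otimes> inv a"
    using a by simp
  also have "\<dots> = inv a \<otimes> x"
    using aC x by (simp add: m_assoc)
  finally show "inv a \<in> {y \<in> carrier G. x \<otimes> y = y \<otimes> x}"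
    using a by simp
next
  fix a b assume ab: "a \<in> {y \<in> carrier G. x \<otimes> y = y \<otimes> x}" "b \<in> {y \<in> carrier G. x \<otimes> y = y \<otimes> x}"
  then show "a \<otimes> b \<in> {y \<in> carrier G. x \<otimes> y = y \<otimes> x}"
    using x by (auto simp: m_assoc[symmetric]) (simp add: m_assoc)
qed auto

lemma (in group) central_conj:
  assumes "z \<in> centre G" "x \<in> carrier G"
  shows "x \<otimes> z \<otimes> inv x = z"
proof -
  have "z \<in> carrier G" "z \<otimes> x = x \<otimes> z"
    using assms by (auto simp: centre_def)
  then show ?thesis
    using assms(2) by (simp add: inv_solve_right')
qed

lemma (in group) centre_normal: "centre G \<lhd> G"
proof (rule normal_invI)
  have "z \<in> centre G \<longleftrightarrow> z \<in> carrier G \<and> (\<forall>x\<in>carrier G. x \<otimes> z = z \<otimes> x)" for z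
    unfolding centre_def mem_Collect_eq by metis
  then have eq: "centre G = carrier G \<inter> (\<Inter>x\<in>carrier G. {y \<in> carrier G. x \<otimes> y = y \<otimes> x})"
    by blast
  have "subgroup (\<Inter>x\<in>carrier G. {y \<in> carrier G. x \<otimes> y = y \<otimes> x}) G"
    by (rule subgroups_Inter) (auto intro: centralizer_subgroup)
  then show "subgroup (centre G) G"
    unfolding eq by (intro subgroups_Inter_pair subgroup_self)
next
  fix x h assume "x \<in> carrier G" "h \<in> centre G"
  then show "x \<otimes> h \<otimes> inv x \<in> centre G"
    by (simp only: central_conj)
qed

lemma (in normal) coset_hom: "group_hom G (G Mod H) (\<lambda>a. H #> a)"
  by (intro group_hom.intro group_hom_axioms.intro group_axioms factorgroup_is_group r_coset_hom_Mod)

lemma (in normal) coset_eq_self_iff: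
  assumes "x \<in> carrier G"
  shows "H #> x = H \<longleftrightarrow> x \<in> H"
  using assms coset_join1 coset_join2 subgroup_axioms subset by blast

lemma (in normal) coset_eq_iff:
  assumes "x \<in> carrier G" "y \<in> carrier G"
  shows "H #> x = H #> y \<longleftrightarrow> x \<otimes> inv y \<in> H"
proof -
  have "H #> x = H #> y \<longleftrightarrow> x \<in> H #> y"
    using assms repr_independence[OF _ assms(2) subgroup_axioms]
      rcos_self[OF assms(1) subgroup_axioms] by auto
  also have "\<dots> \<longleftrightarrow> x \<otimes> inv y \<in> H"
    using assms by (intro rcos_module is_group)
  finally show ?thesis .
qed

text \<open>The commutator of two cosets is the coset of the commutator. With \<open>H\<close> a
  term of the upper central series, this identifies the next term with the preimage of the centre of
  the quotient.\<close>

lemma (in normal) coset_in_centre_iff: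
  assumes x: "x \<in> carrier G"
  shows "H #> x \<in> centre (G Mod H) \<longleftrightarrow> (\<forall>y\<in>carrier G. x \<otimes> y \<otimes> inv x \<otimes> inv y \<in> H)"
proof -
  interpret q: group_hom G "G Mod H" "\<lambda>a. H #> a" by (rule coset_hom)
  have "(H #> x) \<otimes>\<^bsub>G Mod H\<^esub> (H #> y) = (H #> y) \<otimes>\<^bsub>G Mod H\<^esub> (H #> x)
     \<longleftrightarrow> x \<otimes> y \<otimes> inv x \<otimes> inv y \<in> H" if y: "y \<in> carrier G" for y
  proof -
    have "H #> (x \<otimes> y \<otimes> inv x \<otimes> inv y) = (H #> x) \<otimes>\<^bsub>G Mod H\<^esub> (H #> y)
        \<otimes>\<^bsub>G Mod H\<^esub> inv\<^bsub>G Mod H\<^esub> (H #> x) \<otimes>\<^bsub>G Mod H\<^esub> inv\<^bsub>G Mod H\<^esub> (H #> y)"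
      using x y q.hom_mult q.hom_inv by (metis inv_closed m_closed)
    then have "H #> (x \<otimes> y \<otimes> inv x \<otimes> inv y) = H \<longleftrightarrow>
        (H #> x) \<otimes>\<^bsub>G Mod H\<^esub> (H #> y) = (H #> y) \<otimes>\<^bsub>G Mod H\<^esub> (H #> x)"
      using q.H.comm_eq_one_iff[of "H #> x" "H #> y"] q.hom_closed x y by (metis one_FactGroup)
    then show ?thesis
      using coset_eq_self_iff[of "x \<otimes> y \<otimes> inv x \<otimes> inv y"] x y
      by (simp del: mult_FactGroup)
  qed
  moreover have "H #> x \<in> carrier (G Mod H)"
    using x q.hom_closed by simp
  ultimately show ?thesis
    unfolding centre_def by (simp add: carrier_FactGroup del: mult_FactGroup)
qed

lemma (in group) upper_central_normal: "upper_central G n \<lhd> G"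
proof (induction n)
  case 0
  show ?case by (simp add: one_is_normal)
next
  case (Suc n)
  interpret N: normal "upper_central G n" G by (rule Suc)
  have "upper_central G (Suc n) =
      {x \<in> carrier G. upper_central G n #> x \<in> centre (G Mod upper_central G n)}"
    using N.coset_in_centre_iff by auto
  then show ?case
    using group_hom.preimage_normal[OF N.coset_hom]
      group.centre_normal[OF N.factorgroup_is_group] by simp
qed

text \<open>Induction on \<open>i\<close>: commutators of an element of term
  \<open>n - Suc i\<close> lie in term \<open>n - i\<close>, hence in the \<open>i\<close>-th upper
  term. The case \<open>i = n - 1\<close> shows that a nilpotent group is exhausted by its upper
  central series.\<close>

lemma (in group) lower_central_le_upper_central:
  assumes "lower_central G n = {\<one>}" "i < n"
  shows "lower_central G (n - i) \<subseteq> upper_central G i"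
  using assms(2)
proof (induction i)
  case 0
  with assms show ?case by simp
next
  case (Suc i)
  \<comment> \<open>\<open>Suc i < n\<close> keeps both indices at 1 or above, where the recursion
    of \<open>lower_central\<close> applies and the dummy value at 0 is avoided.\<close>
  have eq: "n - i = Suc (Suc (n - Suc (Suc i)))" "n - Suc i = Suc (n - Suc (Suc i))"
    using Suc.prems by auto
  have IH: "lower_central G (n - i) \<subseteq> upper_central G i"
    using Suc by simp
  show ?case
  proof
    fix x assume x: "x \<in> lower_central G (n - Suc i)"
    then have "x \<otimes> y \<otimes> inv x \<otimes> inv y \<in> lower_central G (n - i)" if "y \<in> carrier G" for y
      using that unfolding eq by (auto intro: generate.incl)
    moreover have "x \<in> carrier G"
      using x subgroup.subset[OF lower_central_subgroup] by blast
    ultimately show "x \<in> upper_central G (Suc i)"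
      using IH by auto
  qed
qed

section \<open>From a torsion centre to a finite group\<close>

lemma (in group) pow_commute_central:
  assumes x: "x \<in> carrier G" and y: "y \<in> carrier G" and c: "c \<in> centre G"
    and eq: "x \<otimes> y = c \<otimes> (y \<otimes> x)"
  shows "x [^] (k::nat) \<otimes> y = c [^] k \<otimes> (y \<otimes> x [^] k)"
proof (induction k)
  case 0
  then show ?case using y by simp
next
  case (Suc k)
  have cC: "c \<in> carrier G" and comm: "\<And>z. z \<in> carrier G \<Longrightarrow> c \<otimes> z = z \<otimes> c"
    using c by (auto simp: centre_def)
  have "x [^] Suc k \<otimes> y = x [^] k \<otimes> (c \<otimes> (y \<otimes> x))"
    using x y by (simp add: m_assoc eq)
  \<comment> \<open>Each \<open>x\<close> that passes \<open>y\<close> leaves behind one factor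
    \<open>c\<close>, which is central and can be collected on the left.\<close>
  also have "\<dots> = c \<otimes> (x [^] k \<otimes> y) \<otimes> x"
    using x y cC comm[of "x [^] k"] by (simp add: m_assoc[symmetric])
  also have "\<dots> = (c \<otimes> c [^] k) \<otimes> (y \<otimes> x [^] Suc k)"
    using x y cC by (simp add: Suc m_assoc)
  also have "c \<otimes> c [^] k = c [^] Suc k"
    using cC nat_pow_Suc2 by simp
  finally show ?case .
qed

text \<open>For \<open>x\<close> central modulo the centre, the commutator of \<open>x [^] k\<close>
  with \<open>s\<close> is the \<open>k\<close>-th power of that of \<open>x\<close> with
  \<open>s\<close>. Finitely many generators need only one common exponent, and then
  \<open>x [^] k\<close> commutes with all of them.\<close>

lemma (in group) power_central_of_torsion_centre:
  assumes S: "finite S" "S \<subseteq> carrier G" "generate G S = carrier G"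
    and tors: "\<And>z. z \<in> centre G \<Longrightarrow> \<exists>k>0. z [^] (k::nat) = \<one>"
    and x: "x \<in> carrier G"
    and comm: "\<And>y. y \<in> carrier G \<Longrightarrow> x \<otimes> y \<otimes> inv x \<otimes> inv y \<in> centre G"
  shows "\<exists>k>0. x [^] (k::nat) \<in> centre G"
proof -
  have "\<forall>s\<in>S. \<exists>k>0. (x \<otimes> s \<otimes> inv x \<otimes> inv s) [^] (k::nat) = \<one>"
    using tors comm S by blast
  then obtain f where f: "\<And>s. s \<in> S \<Longrightarrow> f s > (0::nat)"
      "\<And>s. s \<in> S \<Longrightarrow> (x \<otimes> s \<otimes> inv x \<otimes> inv s) [^] f s = \<one>"
    by metis
  \<comment> \<open>The product serves as a common multiple of the exponents killing the individual
    commutators.\<close>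
  define k where "k = prod f S"
  have k: "k > 0"
    using f S by (simp add: k_def prod_pos)
  have "s \<in> {y \<in> carrier G. x [^] k \<otimes> y = y \<otimes> x [^] k}" if s: "s \<in> S" for s
  proof -
    let ?c = "x \<otimes> s \<otimes> inv x \<otimes> inv s"
    have sC: "s \<in> carrier G" using s S by blast
    have cC: "?c \<in> carrier G" using x sC by simp
    have "x \<otimes> s = ?c \<otimes> (s \<otimes> x)"
      using x sC inv_solve_right'[of "?c" "x \<otimes> s" "s \<otimes> x"] by (simp add: inv_mult_group m_assoc)
    then have "x [^] k \<otimes> s = ?c [^] k \<otimes> (s \<otimes> x [^] k)"
      by (intro pow_commute_central x sC comm)
    moreover have "?c [^] k = \<one>"
    proof -
      obtain m where "k = f s * m"
        using S s dvd_prodI[of S s f] by (auto simp: k_def dvd_def)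
      then show ?thesis
        using f(2)[OF s] cC by (metis nat_pow_one nat_pow_pow)
    qed
    ultimately show ?thesis
      using sC x by simp
  qed
  then have "carrier G \<subseteq> {y \<in> carrier G. x [^] k \<otimes> y = y \<otimes> x [^] k}"
    using generate_subgroup_incl[OF _ centralizer_subgroup[of "x [^] k"], of S] x S by auto
  then have "x [^] k \<in> centre G"
    using x by (auto simp: centre_def)
  with k show ?thesis by blast
qed

text \<open>Adjoin one generator at a time: a central \<open>b\<close> spans a finite normal cyclic
  subgroup, and its product with the finite subgroup already obtained is a finite subgroup
  containing the new generating set.\<close>

lemma (in group) finite_generate_central:
  assumes "finite B" "B \<subseteq> centre G"
    and tors: "\<And>x. x \<in> carrier G \<Longrightarrow> \<exists>k>0. x [^] (k::nat) = \<one>"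
  shows "finite (generate G B)"
  using assms(1,2)
proof (induction B)
  case empty
  then show ?case by (simp add: generate_empty)
next
  case (insert b B)
  have b: "b \<in> carrier G" and bc: "b \<in> centre G" and B: "B \<subseteq> carrier G"
    using insert.prems by (auto simp: centre_def)
  have sub: "generate G {b} \<subseteq> centre G"
    using bc by (intro generate_subgroup_incl normal_imp_subgroup centre_normal) simp
  have norm: "generate G {b} \<lhd> G"
  proof (rule normal_invI)
    show "subgroup (generate G {b}) G" using b by (intro generate_is_subgroup) simp
    fix x h assume x: "x \<in> carrier G" and h: "h \<in> generate G {b}"
    then have "h \<in> centre G" using sub by blast
    then have "x \<otimes> h \<otimes> inv x = h"
      using x by (rule central_conj)
    with h show "x \<otimes> h \<otimes> inv x \<in> generate G {b}" by simp
  qed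
  have "ord b \<noteq> 0"
    using tors[OF b] ord_eq_0[OF b] by blast
  then have "finite (generate G {b})"
    using b finite_cyclic_subgroup_order[OF b] by (simp add: carrier_subgroup_generated)
  then have fin: "finite (generate G {b} <#> generate G B)"
    using insert by (auto simp: set_mult_def)
  have "subgroup (generate G {b} <#> generate G B) G"
    by (intro mult_norm_subgroup norm generate_is_subgroup B)
  moreover have "insert b B \<subseteq> generate G {b} <#> generate G B"
  proof
    fix z assume "z \<in> insert b B"
    then have "z = b \<otimes> \<one> \<and> b \<in> generate G {b} \<or> z = \<one> \<otimes> z \<and> z \<in> generate G B"
      using b B by (auto intro: generate.incl)
    then show "z \<in> generate G {b} <#> generate G B"
      unfolding set_mult_def using generate.one by blast
  qed
  ultimately have "generate G (insert b B) \<subseteq> generate G {b} <#> generate G B"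
    by (intro generate_subgroup_incl)
  then show ?case
    using fin by (rule finite_subset)
qed

text \<open>A Schreier-type argument. Rewriting each product of a representative and a generator as
  a central factor times a representative yields finitely many central factors. They generate a
  finite subgroup \<open>D\<close>, and \<open>D\<close> times the representatives is already
  everything.\<close>

lemma (in group) finite_of_torsion_centre_finite_index:
  assumes S: "finite S" "S \<subseteq> carrier G" "generate G S = carrier G"
    and tors: "\<And>x. x \<in> carrier G \<Longrightarrow> \<exists>k>0. x [^] (k::nat) = \<one>"
    and T: "finite T" "T \<subseteq> carrier G" "carrier G \<subseteq> centre G <#> T"
  shows "finite (carrier G)"
proof -
  \<comment> \<open>The identity is added so that it lies in \<open>W\<close> below;
    \<open>R\<close> contains the inverses because elements of \<open>generate G S\<close> are words
    in generators and their inverses.\<close>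
  define U where "U = insert \<one> T"
  define R where "R = S \<union> (\<lambda>s. inv s) ` S"
  have U: "finite U" "U \<subseteq> carrier G" "\<one> \<in> U" and R: "finite R" "R \<subseteq> carrier G"
    using S T by (auto simp: U_def R_def)
  have "\<forall>p\<in>U \<times> R. \<exists>z\<in>centre G. \<exists>t\<in>U. fst p \<otimes> snd p = z \<otimes> t"
  proof
    fix p assume "p \<in> U \<times> R"
    then have "fst p \<otimes> snd p \<in> carrier G"
      using U(2) R(2) by (intro m_closed) auto
    then show "\<exists>z\<in>centre G. \<exists>t\<in>U. fst p \<otimes> snd p = z \<otimes> t"
      using T unfolding set_mult_def U_def by blast
  qed
  then obtain f where f: "\<And>p. p \<in> U \<times> R \<Longrightarrow> f p \<in> centre G"
      "\<And>p. p \<in> U \<times> R \<Longrightarrow> \<exists>t\<in>U. fst p \<otimes> snd p = f p \<otimes> t"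
    by metis
  define D where "D = generate G (f ` (U \<times> R))"
  define W where "W = D <#> U"
  have fC: "f ` (U \<times> R) \<subseteq> centre G" "centre G \<subseteq> carrier G"
    using f by (auto simp: centre_def)
  have finD: "finite D"
    unfolding D_def using U R fC tors by (intro finite_generate_central) auto
  interpret D: subgroup D G
    unfolding D_def using fC by (intro generate_is_subgroup) blast
  have step: "w \<otimes> r \<in> W" if w: "w \<in> W" and r: "r \<in> R" for w r
  proof -
    obtain d u where du: "d \<in> D" "u \<in> U" "w = d \<otimes> u"
      using w by (auto simp: W_def set_mult_def)
    obtain t where t: "t \<in> U" "u \<otimes> r = f (u, r) \<otimes> t"
      using f(2)[of "(u, r)"] du r by auto
    have fD: "f (u, r) \<in> D"
      unfolding D_def using du r by (intro generate.incl) auto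
    have C: "d \<in> carrier G" "u \<in> carrier G" "r \<in> carrier G" "t \<in> carrier G" "f (u, r) \<in> carrier G"
      using du t r fD U R by auto
    have "w \<otimes> r = d \<otimes> (u \<otimes> r)"
      unfolding du(3) using C by (simp only: m_assoc)
    also have "\<dots> = (d \<otimes> f (u, r)) \<otimes> t"
      unfolding t(2) using C by (simp only: m_assoc)
    finally have "w \<otimes> r = (d \<otimes> f (u, r)) \<otimes> t" .
    then show ?thesis
      unfolding W_def set_mult_def using du fD t by blast
  qed
  have W: "W \<subseteq> carrier G"
    using U by (auto simp: W_def set_mult_def)
  \<comment> \<open>\<open>W\<close> is not known to be a subgroup, so the induction over words
    shows stability of \<open>W\<close> under right multiplication; applied to the identity this
    gives membership.\<close>
  have closed: "\<forall>w\<in>W. w \<otimes> g \<in> W" if "g \<in> generate G S" for g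
    using that
  proof (induction g)
    case one
    then show ?case using W by auto
  next
    case (eng h1 h2)
    then have "h1 \<in> carrier G" "h2 \<in> carrier G" using S by auto
    then have "w \<otimes> (h1 \<otimes> h2) = w \<otimes> h1 \<otimes> h2" if "w \<in> W" for w
      using that W m_assoc by auto
    then show ?case
      using eng.IH by simp
  qed (auto simp: R_def intro: step)
  have one_W: "\<one> \<in> W"
  proof -
    have "\<one> = \<one> \<otimes> \<one>" by simp
    then show ?thesis
      unfolding W_def set_mult_def using U(3) D.one_closed by blast
  qed
  have "carrier G \<subseteq> W"
  proof
    fix g assume g: "g \<in> carrier G"
    then have "\<one> \<otimes> g \<in> W"
      using closed[of g] one_W S(3) by blast
    with g show "g \<in> W" by simp
  qed
  moreover have "finite W"
    using finD U by (auto simp: W_def set_mult_def)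
  ultimately show ?thesis
    by (rule finite_subset)
qed

text \<open>
  If \<open>[x, y]\<close> is central modulo \<open>Z\<^sub>i\<close>, then \<open>[x\<^sup>k, y] \<equiv> [x, y]\<^sup>k\<close>; as \<open>G\<close> is finitely generated, a single
  \<open>k\<close> kills these commutators for all generators \<open>y\<close>.
\<close>

lemma (in group) upper_central_torsion:
  assumes S: "finite S" "S \<subseteq> carrier G" "generate G S = carrier G"
    and tors: "\<And>z. z \<in> centre G \<Longrightarrow> \<exists>k>0. z [^] (k::nat) = \<one>"
  shows "x \<in> upper_central G (Suc i) \<Longrightarrow> \<exists>k>0. x [^] (k::nat) \<in> upper_central G i"
proof (induction i arbitrary: x)
  case 0
  then have "x \<in> carrier G" "\<forall>y\<in>carrier G. x \<otimes> y \<otimes> inv x \<otimes> inv y = \<one>"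
    by auto
  then have "x \<in> centre G"
    unfolding centre_def using comm_eq_one_iff by blast
  with tors show ?case by auto
next
  case (Suc i)
  define N where "N = upper_central G i"
  interpret N: normal N G unfolding N_def by (rule upper_central_normal)
  interpret q: group_hom G "G Mod N" "\<lambda>a. N #> a" by (rule N.coset_hom)
  have cen: "N #> z \<in> centre (G Mod N) \<longleftrightarrow> z \<in> upper_central G (Suc i)" if "z \<in> carrier G" for z
    using N.coset_in_centre_iff[OF that] that by (simp add: N_def)
  have x: "x \<in> carrier G"
    using Suc.prems by simp
  \<comment> \<open>The preceding argument is applied in the quotient by the \<open>i\<close>-th
    term: its centre is the image of the next term, which is torsion by the induction
    hypothesis.\<close>
  have "\<exists>k>0. (N #> x) [^]\<^bsub>G Mod N\<^esub> (k::nat) \<in> centre (G Mod N)"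
  proof (rule q.H.power_central_of_torsion_centre[of "(\<lambda>a. N #> a) ` S"])
    show "generate (G Mod N) ((\<lambda>a. N #> a) ` S) = carrier (G Mod N)"
      using q.generate_img[OF S(2)] S(3) by (simp add: carrier_FactGroup)
    show "(\<lambda>a. N #> a) ` S \<subseteq> carrier (G Mod N)"
      using S by (auto simp: carrier_FactGroup)
    show "N #> x \<in> carrier (G Mod N)"
      using x by (rule q.hom_closed)
  next
    fix Z assume Z: "Z \<in> centre (G Mod N)"
    then obtain z where z: "z \<in> carrier G" "Z = N #> z"
      by (auto simp: centre_def carrier_FactGroup)
    then obtain k where k: "k > 0" "z [^] (k::nat) \<in> N"
      using Suc.IH[of z] Z cen by (auto simp: N_def)
    then have "Z [^]\<^bsub>G Mod N\<^esub> k = \<one>\<^bsub>G Mod N\<^esub>"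
      using z N.coset_eq_self_iff[of "z [^] k"] q.hom_nat_pow[of z k] by simp
    with k show "\<exists>k>0. Z [^]\<^bsub>G Mod N\<^esub> (k::nat) = \<one>\<^bsub>G Mod N\<^esub>"
      by blast
  next
    fix Y assume "Y \<in> carrier (G Mod N)"
    then obtain y where y: "y \<in> carrier G" "Y = N #> y"
      by (auto simp: carrier_FactGroup)
    have "x \<otimes> y \<otimes> inv x \<otimes> inv y \<in> upper_central G (Suc i)"
      using Suc.prems y(1) by (simp only: upper_central.simps) blast
    moreover have "x \<otimes> y \<otimes> inv x \<otimes> inv y \<in> carrier G"
      using x y by simp
    ultimately have "N #> (x \<otimes> y \<otimes> inv x \<otimes> inv y) \<in> centre (G Mod N)"
      using cen by blast
    moreover have "N #> (x \<otimes> y \<otimes> inv x \<otimes> inv y) = (N #> x) \<otimes>\<^bsub>G Mod N\<^esub> Y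
        \<otimes>\<^bsub>G Mod N\<^esub> inv\<^bsub>G Mod N\<^esub> (N #> x) \<otimes>\<^bsub>G Mod N\<^esub> inv\<^bsub>G Mod N\<^esub> Y"
      using x y q.hom_mult q.hom_inv by (metis inv_closed m_closed)
    ultimately show "(N #> x) \<otimes>\<^bsub>G Mod N\<^esub> Y
        \<otimes>\<^bsub>G Mod N\<^esub> inv\<^bsub>G Mod N\<^esub> (N #> x) \<otimes>\<^bsub>G Mod N\<^esub> inv\<^bsub>G Mod N\<^esub> Y \<in> centre (G Mod N)"
      by (simp only:)
  qed (use S in simp)
  then obtain k where k: "k > 0" "(N #> x) [^]\<^bsub>G Mod N\<^esub> (k::nat) \<in> centre (G Mod N)"
    by blast
  then have "N #> (x [^] k) \<in> centre (G Mod N)"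
    using q.hom_nat_pow[OF x] by (simp only:)
  then have "x [^] k \<in> upper_central G (Suc i)"
    using cen[of "x [^] k"] x by blast
  with k show ?case
    by blast
qed

text \<open>The quotient by the \<open>i\<close>-th term is finitely generated and torsion, and its
  centre is the image of the next term, so it has finite index by \<open>fin\<close>.\<close>

lemma (in group) upper_central_finite_index_step:
  assumes S: "finite S" "S \<subseteq> carrier G" "generate G S = carrier G"
    and tors: "\<And>x. x \<in> carrier G \<Longrightarrow> \<exists>k>0. x [^] (k::nat) = \<one>"
    and fin: "finite (carrier (G Mod upper_central G (Suc i)))"
  shows "finite (carrier (G Mod upper_central G i))"
proof -
  define N where "N = upper_central G i"
  define M where "M = upper_central G (Suc i)"
  interpret N: normal N G unfolding N_def by (rule upper_central_normal)
  interpret M: normal M G unfolding M_def by (rule upper_central_normal)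
  interpret q: group_hom G "G Mod N" "\<lambda>a. N #> a" by (rule N.coset_hom)
  have "finite ((\<lambda>x. M #> x) ` carrier G)"
    using fin unfolding M_def by (simp add: carrier_FactGroup)
  then obtain R where R: "R \<subseteq> carrier G" "finite R" "(\<lambda>x. M #> x) ` carrier G = (\<lambda>x. M #> x) ` R"
    by (metis finite_subset_image order_refl)
  have "finite (carrier (G Mod N))"
  proof (rule q.H.finite_of_torsion_centre_finite_index)
    show "generate (G Mod N) ((\<lambda>a. N #> a) ` S) = carrier (G Mod N)"
      using q.generate_img[OF S(2)] S(3) by (simp add: carrier_FactGroup)
    show "(\<lambda>a. N #> a) ` S \<subseteq> carrier (G Mod N)" "(\<lambda>a. N #> a) ` R \<subseteq> carrier (G Mod N)"
      using S R by (auto simp: carrier_FactGroup)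
    show "carrier (G Mod N) \<subseteq> centre (G Mod N) <#>\<^bsub>G Mod N\<^esub> (\<lambda>a. N #> a) ` R"
    proof
      fix A assume "A \<in> carrier (G Mod N)"
      then obtain x where x: "x \<in> carrier G" "A = N #> x"
        by (auto simp: carrier_FactGroup)
      then have "M #> x \<in> (\<lambda>x. M #> x) ` R"
        using R by blast
      then obtain r where r: "r \<in> R" "M #> x = M #> r"
        by blast
      have rC: "r \<in> carrier G" using r R by blast
      then have "x \<otimes> inv r \<in> M"
        using r x M.coset_eq_iff by blast
      then have "N #> (x \<otimes> inv r) \<in> centre (G Mod N)"
        using N.coset_in_centre_iff[of "x \<otimes> inv r"]
        unfolding M_def N_def upper_central.simps by blast
      moreover have "A = (N #> (x \<otimes> inv r)) \<otimes>\<^bsub>G Mod N\<^esub> (N #> r)"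
      proof -
        have xr: "x \<otimes> inv r \<in> carrier G" and eq: "x \<otimes> inv r \<otimes> r = x"
          using x rC by (simp_all add: m_assoc)
        show ?thesis
          using q.hom_mult[OF xr rC] unfolding eq x(2) .
      qed
      ultimately show "A \<in> centre (G Mod N) <#>\<^bsub>G Mod N\<^esub> (\<lambda>a. N #> a) ` R"
        unfolding set_mult_def[of "G Mod N"] using r by blast
    qed
    fix A assume "A \<in> carrier (G Mod N)"
    then obtain x where x: "x \<in> carrier G" "A = N #> x"
      by (auto simp: carrier_FactGroup)
    from tors[OF x(1)] obtain k where k: "k > 0" "x [^] (k::nat) = \<one>"
      by blast
    have "A [^]\<^bsub>G Mod N\<^esub> k = \<one>\<^bsub>G Mod N\<^esub>"
      unfolding x(2) q.hom_nat_pow[OF x(1), symmetric] k(2) by (rule q.hom_one)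
    with k(1) show "\<exists>k>0. A [^]\<^bsub>G Mod N\<^esub> (k::nat) = \<one>\<^bsub>G Mod N\<^esub>"
      by blast
  qed (use S R in simp_all)
  then show ?thesis by (simp add: N_def)
qed

text \<open>Two passes through the upper central series: upwards, torsion spreads from the centre to
  the whole group; downwards from the top, where the quotient is trivial, finiteness of the
  quotients spreads to the group itself.\<close>

lemma (in group) finite_of_nilpotent_torsion_centre:
  assumes fg: "finitely_generated_group G" and nil: "nilpotent_group G"
    and tors: "\<And>z. z \<in> centre G \<Longrightarrow> \<exists>k>0. z [^] (k::nat) = \<one>"
  shows "finite (carrier G)"
proof -
  obtain S where S: "finite S" "S \<subseteq> carrier G" "generate G S = carrier G"
    using fg by (auto simp: finitely_generated_group_def)
  obtain n where n: "n \<ge> 1" "lower_central G n = {\<one>}"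
    using nil by (auto simp: nilpotent_group_def)
  have "carrier G \<subseteq> upper_central G (n - 1)"
    using lower_central_le_upper_central[OF n(2), of "n - 1"] n(1) by simp
  then have top: "upper_central G (n - 1) = carrier G"
    using normal_imp_subgroup[OF upper_central_normal] subgroup.subset by blast
  have "x \<in> upper_central G i \<Longrightarrow> \<exists>k>0. x [^] (k::nat) = \<one>" for x i
  proof (induction i arbitrary: x)
    case 0
    then show ?case by auto
  next
    case (Suc i)
    from upper_central_torsion[OF S tors Suc.prems]
    obtain k where k: "k > 0" "x [^] (k::nat) \<in> upper_central G i"
      by blast
    then obtain l where "l > 0" "(x [^] k) [^] (l::nat) = \<one>"
      using Suc.IH by blast
    moreover have "x \<in> carrier G"
      using Suc.prems by simp
    ultimately show ?case
      using k by (intro exI[of _ "k * l"]) (simp add: nat_pow_pow)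
  qed
  then have torsG: "\<exists>k>0. x [^] (k::nat) = \<one>" if "x \<in> carrier G" for x
    using that top by blast
  \<comment> \<open>Start of the descending induction from index \<open>n - 1\<close> to 0.\<close>
  have "0 \<le> n - 1" by simp
  then have "finite (carrier (G Mod upper_central G 0))"
  proof (induction rule: inc_induct)
    case base
    have "carrier (G Mod carrier G) \<subseteq> {carrier G}"
      using coset_join2[OF _ subgroup_self] by (auto simp: carrier_FactGroup)
    then show ?case
      unfolding top by (rule finite_subset) simp
  next
    case (step i)
    from upper_central_finite_index_step[OF S torsG step.IH] show ?case .
  qed
  then have "finite ((\<lambda>x. {\<one>} #> x) ` carrier G)"
    by (simp add: carrier_FactGroup)
  moreover have "inj_on (\<lambda>x. {\<one>} #> x) (carrier G)"
    by (auto simp: inj_on_def r_coset_def)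
  ultimately show ?thesis
    by (rule finite_imageD)
qed

text \<open>Every nontrivial central element generates a normal subgroup, so \<open>q\<close> is one
  of its powers. An infinite cyclic central subgroup is impossible, because the intersection of its
  nontrivial subgroups is trivial.\<close>

lemma (in group) centre_torsion_of_monolithic:
  assumes q: "q \<in> carrier G" "q \<noteq> \<one>"
    and mono: "\<And>K. K \<lhd> G \<Longrightarrow> K \<noteq> {\<one>} \<Longrightarrow> q \<in> K"
    and z: "z \<in> centre G"
  shows "\<exists>k>0. z [^] (k::nat) = \<one>"
proof -
  have in_powers: "\<exists>j::int. q = w [^] j" if w: "w \<in> centre G" "w \<noteq> \<one>" for w
  proof -
    have wC: "w \<in> carrier G" using w by (simp add: centre_def)
    have sub: "generate G {w} \<subseteq> centre G"
      using w by (intro generate_subgroup_incl normal_imp_subgroup centre_normal) simp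
    have "generate G {w} \<lhd> G"
    proof (rule normal_invI)
      show "subgroup (generate G {w}) G" using wC by (intro generate_is_subgroup) simp
      fix x h assume x: "x \<in> carrier G" and h: "h \<in> generate G {w}"
      then have "x \<otimes> h \<otimes> inv x = h"
        using sub by (intro central_conj) auto
      with h show "x \<otimes> h \<otimes> inv x \<in> generate G {w}" by simp
    qed
    moreover have "generate G {w} \<noteq> {\<one>}"
      using w generate.incl[of w "{w}" G] by auto
    ultimately have "q \<in> generate G {w}"
      by (rule mono)
    then show ?thesis
      using generate_pow[OF wC] by auto
  qed
  have zC: "z \<in> carrier G" using z by (simp add: centre_def)
  show ?thesis
  proof (cases "z = \<one>")
    case True
    then show ?thesis by (intro exI[of _ 1]) simp
  next
    case False
    from in_powers[OF z False] obtain j :: int where j: "q = z [^] j"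
      by blast
    have "j \<noteq> 0"
    proof
      assume "j = 0"
      with j have "q = \<one>" by simp
      with q show False by simp
    qed
    have "\<exists>i::int. i \<noteq> 0 \<and> z [^] i = \<one>"
    \<comment> \<open>With \<open>q\<close> equal to \<open>z [^] j\<close>, the subgroup of the
      doubled power must also contain \<open>q\<close>. This gives a relation whose exponent is
      \<open>j\<close> times an odd number, hence nonzero.\<close>
    proof (cases "z [^] (j * 2) = \<one>")
      case True
      with \<open>j \<noteq> 0\<close> show ?thesis by (intro exI[of _ "j * 2"]) simp
    next
      case False
      have "z [^] (j * 2) \<in> centre G"
        using subgroup_int_pow_closed[OF normal_imp_subgroup[OF centre_normal] z] .
      from in_powers[OF this False] obtain l :: int where l: "q = (z [^] (j * 2)) [^] l"
        by blast
      have "z [^] (j * 2 * l) = z [^] j"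
        using l unfolding j int_pow_pow[OF zC] by (rule sym)
      then have "z [^] (j * 2 * l - j) = \<one>"
        unfolding int_pow_diff[OF zC] using zC by simp
      moreover have "j * 2 * l - j \<noteq> 0"
      proof -
        have "j * 2 * l - j = j * (2 * l - 1)" by (simp add: algebra_simps)
        moreover have "2 * l - 1 \<noteq> 0" by presburger
        ultimately show ?thesis using \<open>j \<noteq> 0\<close> by simp
      qed
      ultimately show ?thesis by blast
    qed
    then have "\<exists>n::nat. n \<noteq> 0 \<and> z [^] n = \<one>"
      unfolding finite_cyclic_subgroup[OF zC, symmetric] finite_cyclic_subgroup_int[OF zC] .
    then show ?thesis by blast
  qed
qed

section \<open>Lower central series of images and quotients\<close>

lemma (in group_hom) lower_central_surj_image:
  assumes "h ` carrier G = carrier H"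
  shows "h ` lower_central G n = lower_central H n"
proof -
  have "h ` lower_central G (Suc m) = lower_central H (Suc m)" for m
  proof (induction m)
    case 0
    show ?case using assms by simp
  next
    case (Suc m)
    let ?S = "{x \<otimes>\<^bsub>G\<^esub> y \<otimes>\<^bsub>G\<^esub> inv\<^bsub>G\<^esub> x \<otimes>\<^bsub>G\<^esub> inv\<^bsub>G\<^esub> y | x y.
                x \<in> lower_central G (Suc m) \<and> y \<in> carrier G}"
    let ?T = "{x \<otimes>\<^bsub>H\<^esub> y \<otimes>\<^bsub>H\<^esub> inv\<^bsub>H\<^esub> x \<otimes>\<^bsub>H\<^esub> inv\<^bsub>H\<^esub> y | x y.
                x \<in> lower_central H (Suc m) \<and> y \<in> carrier H}"
    have sub: "lower_central G (Suc m) \<subseteq> carrier G"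
      using G.lower_central_subgroup by (rule subgroup.subset)
    then have S: "?S \<subseteq> carrier G"
      by auto
    \<comment> \<open>Only this inclusion uses surjectivity: both entries of a commutator in
      \<open>H\<close> are lifted, the first by the induction hypothesis.\<close>
    have "?T \<subseteq> h ` ?S"
    proof
      fix z assume "z \<in> ?T"
      then obtain x y where "x \<in> h ` lower_central G (Suc m)" "y \<in> h ` carrier G"
        and z: "z = x \<otimes>\<^bsub>H\<^esub> y \<otimes>\<^bsub>H\<^esub> inv\<^bsub>H\<^esub> x \<otimes>\<^bsub>H\<^esub> inv\<^bsub>H\<^esub> y"
        unfolding Suc assms by blast
      then obtain a b where ab: "a \<in> lower_central G (Suc m)" "b \<in> carrier G" "x = h a" "y = h b"
        by blast
      have a: "a \<in> carrier G"
        using ab sub by blast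
      have "z = h (a \<otimes>\<^bsub>G\<^esub> b \<otimes>\<^bsub>G\<^esub> inv\<^bsub>G\<^esub> a \<otimes>\<^bsub>G\<^esub> inv\<^bsub>G\<^esub> b)"
        using a ab by (simp add: z)
      then show "z \<in> h ` ?S"
        using ab by blast
    qed
    then have "generate H ?T \<subseteq> generate H (h ` ?S)"
      by (rule H.mono_generate)
    then have "lower_central H (Suc (Suc m)) \<subseteq> h ` lower_central G (Suc (Suc m))"
      using generate_img[OF S] by simp
    then show ?case
      using lower_central_image[of "Suc (Suc m)"] by blast
  qed
  then show ?thesis
    using assms by (cases n) auto
qed

lemma (in normal) lower_central_FactGroup:
  "lower_central (G Mod H) n = (\<lambda>a. H #> a) ` lower_central G n"
  using group_hom.lower_central_surj_image[OF coset_hom] by (simp add: carrier_FactGroup)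

text \<open>The lower central series of the quotient is the image of that of \<open>G\<close>. In
  this form it is evident that nilpotency of a quotient passes to larger kernels.\<close>

lemma (in normal) nilpotent_FactGroup_iff:
  "nilpotent_group (G Mod H) \<longleftrightarrow> (\<exists>n\<ge>1. lower_central G n \<subseteq> H)"
proof -
  have "lower_central (G Mod H) n = {H} \<longleftrightarrow> lower_central G n \<subseteq> H" for n
  proof -
    interpret L: subgroup "lower_central G n" G by (rule lower_central_subgroup)
    have "lower_central (G Mod H) n = {H} \<longleftrightarrow> (\<forall>x\<in>lower_central G n. H #> x = H)"
      unfolding lower_central_FactGroup using L.one_closed by blast
    moreover have "H #> x = H \<longleftrightarrow> x \<in> H" if "x \<in> lower_central G n" for x
      by (rule coset_eq_self_iff[OF L.mem_carrier[OF that]])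
    ultimately show ?thesis
      by auto
  qed
  then show ?thesis
    by (simp add: nilpotent_group_def factorgroup_is_group)
qed

lemma (in normal) finitely_generated_FactGroup:
  assumes "finitely_generated_group G"
  shows "finitely_generated_group (G Mod H)"
proof -
  obtain S where S: "finite S" "S \<subseteq> carrier G" "generate G S = carrier G"
    using assms by (auto simp: finitely_generated_group_def)
  then have "generate (G Mod H) ((\<lambda>a. H #> a) ` S) = carrier (G Mod H)"
    using group_hom.generate_img[OF coset_hom S(2)] by (simp add: carrier_FactGroup)
  moreover have "(\<lambda>a. H #> a) ` S \<subseteq> carrier (G Mod H)"
    using S by (auto simp: carrier_FactGroup)
  ultimately show ?thesis
    unfolding finitely_generated_group_def using factorgroup_is_group S(1) by blast
qed

section \<open>Separating an element from a nilpotent kernel by Zorn's lemma\<close>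

lemma (in group) chain_Union_normal:
  assumes "\<C> \<noteq> {}" "subset.chain {N. N \<lhd> G} \<C>"
  shows "\<Union>\<C> \<lhd> G"
proof (rule normal_invI)
  have norm: "N \<lhd> G" if "N \<in> \<C>" for N
    using assms that by (auto simp: subset.chain_def)
  have sub: "subgroup N G" if "N \<in> \<C>" for N
    using norm[OF that] by (rule normal_imp_subgroup)
  show "subgroup (\<Union>\<C>) G"
  proof (rule subgroupI)
    show "\<Union>\<C> \<subseteq> carrier G"
      using subgroup.subset[OF sub] by blast
    show "\<Union>\<C> \<noteq> {}"
      using assms(1) subgroup.one_closed[OF sub] by blast
    show "inv a \<in> \<Union>\<C>" if "a \<in> \<Union>\<C>" for a
      using that subgroup.m_inv_closed[OF sub] by blast
    fix a b assume "a \<in> \<Union>\<C>" "b \<in> \<Union>\<C>"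
    then obtain A B where AB: "A \<in> \<C>" "B \<in> \<C>" "a \<in> A" "b \<in> B" by blast
    then have "A \<subseteq> B \<or> B \<subseteq> A"
      using assms(2) by (auto simp: subset.chain_def)
    then show "a \<otimes> b \<in> \<Union>\<C>"
      using AB subgroup.m_closed[OF sub] by blast
  qed
  fix x h assume "x \<in> carrier G" "h \<in> \<Union>\<C>"
  then show "x \<otimes> h \<otimes> inv x \<in> \<Union>\<C>"
    using normal.inv_op_closed2[OF norm] by blast
qed

text \<open>
  A normal subgroup maximal among those avoiding \<open>g\<close> has a quotient in which every nontrivial normal
  subgroup contains the image of \<open>g\<close>. This makes the centre of the quotient torsion, hence the quotient finite.
\<close>

lemma (in group) nilpotent_quotient_residually_finite:
  assumes fg: "finitely_generated_group G"
    and N0: "N0 \<in> nilpotent_quotient_kernels G" and g: "g \<in> carrier G" "g \<notin> N0"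
  shows "\<exists>N\<in>finite_quotient_kernels G. N0 \<subseteq> N \<and> g \<notin> N"
proof -
  have N0n: "N0 \<lhd> G" and nil0: "nilpotent_group (G Mod N0)"
    using N0 by (auto simp: nilpotent_quotient_kernels_def)
  define \<A> where "\<A> = {N. N \<lhd> G \<and> N0 \<subseteq> N \<and> g \<notin> N}"
  have "\<exists>N\<in>\<A>. \<forall>K\<in>\<A>. N \<subseteq> K \<longrightarrow> K = N"
  proof (rule subset_Zorn_nonempty)
    show "\<A> \<noteq> {}" using N0n g by (auto simp: \<A>_def)
    fix \<C> assume C: "\<C> \<noteq> {}" "subset.chain \<A> \<C>"
    then have CA: "\<C> \<subseteq> \<A>"
      by (simp add: subset.chain_def)
    have "subset.chain {N. N \<lhd> G} \<C>"
      using C(2) by (auto simp: \<A>_def subset.chain_def)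
    from chain_Union_normal[OF C(1) this] show "\<Union>\<C> \<in> \<A>"
      using CA C(1) unfolding \<A>_def by blast
  qed
  then obtain N where NA: "N \<in> \<A>" and max_A: "\<And>K. K \<in> \<A> \<Longrightarrow> N \<subseteq> K \<Longrightarrow> K = N"
    by metis
  have N: "N \<lhd> G" "N0 \<subseteq> N" "g \<notin> N"
    using NA by (simp_all add: \<A>_def)
  \<comment> \<open>Containment of \<open>N0\<close> is inherited from \<open>N\<close>, so
    maximality holds among all normal subgroups above \<open>N\<close> that avoid
    \<open>g\<close>.\<close>
  have max: "K = N" if "K \<lhd> G" "N \<subseteq> K" "g \<notin> K" for K
    using max_A[of K] that N by (auto simp: \<A>_def)
  interpret N: normal N G by (rule N)
  interpret Q: group "G Mod N" by (rule N.factorgroup_is_group)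
  have "finite (carrier (G Mod N))"
  proof (rule Q.finite_of_nilpotent_torsion_centre)
    show "finitely_generated_group (G Mod N)"
      using fg by (rule N.finitely_generated_FactGroup)
    show "nilpotent_group (G Mod N)"
      using nil0 N(2) unfolding N.nilpotent_FactGroup_iff normal.nilpotent_FactGroup_iff[OF N0n]
      by blast
    fix Z assume "Z \<in> centre (G Mod N)"
    then show "\<exists>k>0. Z [^]\<^bsub>G Mod N\<^esub> (k::nat) = \<one>\<^bsub>G Mod N\<^esub>"
    proof (rule Q.centre_torsion_of_monolithic[rotated -1])
      show "N #> g \<in> carrier (G Mod N)"
        using g by (auto simp: carrier_FactGroup)
      show "N #> g \<noteq> \<one>\<^bsub>G Mod N\<^esub>"
        using g N by (simp add: N.coset_eq_self_iff)
      fix K assume K: "K \<lhd> G Mod N" "K \<noteq> {\<one>\<^bsub>G Mod N\<^esub>}"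
      \<comment> \<open>\<open>K\<close> is a set of cosets, so its union is its preimage in
        \<open>G\<close>. For nontrivial \<open>K\<close> this is strictly larger than
        \<open>N\<close>, and maximality forces it to contain \<open>g\<close>.\<close>
      have U: "\<Union>K = {x \<in> carrier G. N #> x \<in> K}"
        using K normal_imp_subgroup N.factgroup_subgroup_union_char by blast
      have NK: "N \<in> K"
        using subgroup.one_closed[OF normal_imp_subgroup[OF K(1)]] by simp
      then obtain C where "C \<in> K" "C \<noteq> N"
        using K(2) by auto
      moreover from this obtain c where "c \<in> carrier G" "C = N #> c"
        using subgroup.subset[OF normal_imp_subgroup[OF K(1)]] by (auto simp: carrier_FactGroup)
      ultimately have "c \<in> \<Union>K" "c \<notin> N"
        using U N.coset_eq_self_iff by auto
      moreover have "N \<subseteq> \<Union>K"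
        using NK by blast
      ultimately have "g \<in> \<Union>K"
        using max[OF N.factgroup_subgroup_union_normal[OF K(1)]] by blast
      then show "N #> g \<in> K"
        using U by blast
    qed
  qed
  then show ?thesis
    using N by (auto simp: finite_quotient_kernels_def)
qed

section \<open>Profinite completions and compactness\<close>

text \<open>
  Tychonoff's theorem for finite discrete factors: each triple \<open>(k, l, R)\<close> is a closed constraint
  on the coordinates \<open>k\<close> and \<open>l\<close>.
\<close>

lemma finite_product_compactness:
  fixes A :: "'i \<Rightarrow> 'b set" and J :: "('i \<times> 'i \<times> ('b \<Rightarrow> 'b \<Rightarrow> bool)) set"
  assumes fin: "\<And>i. i \<in> I \<Longrightarrow> finite (A i)"
    and J: "\<And>k l R. (k, l, R) \<in> J \<Longrightarrow> k \<in> I \<and> l \<in> I"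
    and sat: "\<And>F. finite F \<Longrightarrow> F \<subseteq> J \<Longrightarrow> \<exists>x\<in>PiE I A. \<forall>(k, l, R)\<in>F. R (x k) (x l)"
  shows "\<exists>x\<in>PiE I A. \<forall>(k, l, R)\<in>J. R (x k) (x l)"
proof -
  define T where "T = product_topology (\<lambda>i. discrete_topology (A i)) I"
  define C where "C = (\<lambda>(k, l, R). {x \<in> PiE I A. R (x k) (x l)})"
  have top: "topspace T = PiE I A"
    by (simp add: T_def)
  have "compact_space T"
    unfolding T_def compact_space_product_topology
    using fin by (simp add: compact_space_discrete_topology)
  moreover have coord: "closedin T {x \<in> PiE I A. x i \<in> B}" if "i \<in> I" for i B
  proof -
    have "continuous_map T (discrete_topology (A i)) (\<lambda>x. x i)"
      unfolding T_def using that by (rule continuous_map_product_projection)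
    then have "closedin T {x \<in> topspace T. x i \<in> B \<inter> A i}"
      by (rule closedin_continuous_map_preimage) simp
    moreover have "{x \<in> topspace T. x i \<in> B \<inter> A i} = {x \<in> PiE I A. x i \<in> B}"
      using that by (auto simp: top)
    ultimately show ?thesis by simp
  qed
  have "closedin T (C j)" if j: "j \<in> J" for j
  proof -
    obtain k l R where jeq: "j = (k, l, R)" by (cases j)
    then have kl: "k \<in> I" "l \<in> I" using J j by auto
    \<comment> \<open>The relation is sliced by the value \<open>a\<close> at \<open>k\<close>;
      since \<open>A k\<close> is finite, the constraint is a finite union of intersections of two
      closed cylinders.\<close>
    let ?D = "\<lambda>a. {x \<in> PiE I A. x k \<in> {a}} \<inter> {x \<in> PiE I A. x l \<in> {b. R a b}}"
    have "closedin T (\<Union>(?D ` A k))"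
    proof (rule closedin_Union)
      show "finite (?D ` A k)"
        using fin kl by simp
      fix S assume "S \<in> ?D ` A k"
      then obtain a where "S = ?D a" by blast
      then show "closedin T S"
        using coord[OF kl(1)] coord[OF kl(2)] by (simp only: closedin_Int)
    qed
    moreover have "C j = \<Union>(?D ` A k)"
      using kl by (auto simp: C_def jeq PiE_iff)
    ultimately show ?thesis by simp
  qed
  \<comment> \<open>The whole product joins the family so that the final intersection lies in it
    even when \<open>J\<close> is empty.\<close>
  then have closed: "\<forall>S\<in>insert (PiE I A) (C ` J). closedin T S"
    using closedin_topspace[of T] top by auto
  have fip: "\<Inter>\<F> \<noteq> {}" if \<F>: "finite \<F>" "\<F> \<subseteq> insert (PiE I A) (C ` J)" for \<F>
  proof -
    have "\<F> - {PiE I A} \<subseteq> C ` J" using \<F> by blast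
    then obtain F where F: "F \<subseteq> J" "finite F" "\<F> - {PiE I A} = C ` F"
      using \<F>(1) finite_subset_image[of "\<F> - {PiE I A}" C J] by auto
    obtain x where x: "x \<in> PiE I A" "\<forall>(k, l, R)\<in>F. R (x k) (x l)"
      using sat[OF F(2,1)] by blast
    then have "x \<in> C j" if "j \<in> F" for j
      using that by (auto simp: C_def)
    then have "x \<in> \<Inter>\<F>"
      using x(1) F(3) by blast
    then show ?thesis by blast
  qed
  ultimately have "\<Inter>(insert (PiE I A) (C ` J)) \<noteq> {}"
    using closed fip unfolding compact_space_fip by meson
  then obtain x where "x \<in> PiE I A" "\<forall>j\<in>J. x \<in> C j"
    by auto
  then show ?thesis
    by (intro bexI[of _ x]) (auto simp: C_def)
qed

section \<open>Points of completions as compatible families of cosets\<close>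

lemma completion_component:
  assumes "x \<in> carrier (completion G \<N>)" "N \<in> \<N>"
  shows "x N \<in> carrier (G Mod N)"
  using assms by (auto simp: completion_def)

lemma completion_compatible:
  assumes "x \<in> carrier (completion G \<N>)" "M \<in> \<N>" "N \<in> \<N>" "M \<subseteq> N"
  shows "quot_map G N (\<lambda>g. g) (x M) = x N"
  using assms by (auto simp: completion_def)

lemma completion_extensional:
  assumes "x \<in> carrier (completion G \<N>)"
  shows "x \<in> extensional \<N>"
  using assms by (auto simp: completion_def PiE_def)

lemma completionI:
  assumes "x \<in> extensional \<N>" "\<And>N. N \<in> \<N> \<Longrightarrow> x N \<in> carrier (G Mod N)"
    and "\<And>M N. M \<in> \<N> \<Longrightarrow> N \<in> \<N> \<Longrightarrow> M \<subseteq> N \<Longrightarrow> quot_map G N (\<lambda>g. g) (x M) = x N"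
  shows "x \<in> carrier (completion G \<N>)"
  using assms by (auto simp: completion_def PiE_def)

lemma one_completion: "\<one>\<^bsub>completion G \<N>\<^esub> = (\<lambda>N\<in>\<N>. N)"
  by (simp add: completion_def)

lemma (in group) quot_map_id_coset:
  assumes "M \<lhd> G" "N \<lhd> G" "M \<subseteq> N" "g \<in> carrier G"
  shows "quot_map G N (\<lambda>g. g) (M #> g) = N #> g"
proof -
  interpret id: group_hom G G "\<lambda>g. g"
    by unfold_locales (auto simp: hom_def)
  show ?thesis
    using assms by (intro id.quot_map_coset) auto
qed

text \<open>These points form the image of the canonical map from \<open>G\<close> to the
  completion.\<close>

lemma (in group) diagonal_in_completion:
  assumes "\<And>N. N \<in> \<N> \<Longrightarrow> N \<lhd> G" "g \<in> carrier G"
  shows "(\<lambda>N\<in>\<N>. N #> g) \<in> carrier (completion G \<N>)"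
  using assms by (intro completionI) (auto simp: carrier_FactGroup quot_map_id_coset)

lemma finite_quotient_kernels_normal: "N \<in> finite_quotient_kernels G \<Longrightarrow> N \<lhd> G"
  by (simp add: finite_quotient_kernels_def)

lemma nilpotent_quotient_kernels_normal: "N \<in> nilpotent_quotient_kernels G \<Longrightarrow> N \<lhd> G"
  by (simp add: nilpotent_quotient_kernels_def)

text \<open>A coset of the intersection is the intersection of the two cosets of the same element,
  so it is determined by a pair from a finite set.\<close>

lemma (in group) finite_quotient_kernels_Int:
  assumes "M \<in> finite_quotient_kernels G" "N \<in> finite_quotient_kernels G"
  shows "M \<inter> N \<in> finite_quotient_kernels G"
proof -
  have MN: "M \<lhd> G" "N \<lhd> G" and fin: "finite (carrier (G Mod M))" "finite (carrier (G Mod N))"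
    using assms by (auto simp: finite_quotient_kernels_def)
  then have norm: "M \<inter> N \<lhd> G"
    by (intro normal_subgroup_intersect)
  define f where "f g = (M #> g, N #> g)" for g
  define e where "e p = fst p \<inter> snd p" for p :: "'a set \<times> 'a set"
  have ef: "(M \<inter> N) #> g = e (f g)" if g: "g \<in> carrier G" for g
  proof -
    have "x \<in> K #> g \<longleftrightarrow> x \<in> carrier G \<and> x \<otimes> inv g \<in> K" if "K \<lhd> G" for K x
    proof -
      interpret K: normal K G by fact
      show ?thesis
        using K.rcos_module[OF is_group g] K.elemrcos_carrier[OF is_group g] by blast
    qed
    then show ?thesis
      using MN norm unfolding e_def f_def fst_conv snd_conv by blast
  qed
  have "f ` carrier G \<subseteq> carrier (G Mod M) \<times> carrier (G Mod N)"
    by (auto simp: f_def carrier_FactGroup)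
  then have "finite (e ` f ` carrier G)"
    by (intro finite_imageI finite_subset[OF _ finite_cartesian_product[OF fin]])
  moreover have "carrier (G Mod (M \<inter> N)) = e ` f ` carrier G"
    using ef by (auto simp: carrier_FactGroup)
  ultimately show ?thesis
    using norm by (simp add: finite_quotient_kernels_def)
qed

text \<open>Compactness replaces the elements of the sets \<open>K - N\<close>, which need not have
  a common member, by one point of the completion. It serves to produce a nontrivial kernel element
  of an induced map.\<close>

lemma (in group) profinite_completion_point_separating:
  assumes N: "N \<in> finite_quotient_kernels G"
    and \<K>: "\<K> \<subseteq> finite_quotient_kernels G" "\<K> \<noteq> {}"
    and Int: "\<And>K L. K \<in> \<K> \<Longrightarrow> L \<in> \<K> \<Longrightarrow> K \<inter> L \<in> \<K>"
    and not_sub: "\<And>K. K \<in> \<K> \<Longrightarrow> \<not> K \<subseteq> N"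
  shows "\<exists>x\<in>carrier (profinite_completion G). (\<forall>K\<in>\<K>. x K = K) \<and> x N \<noteq> N"
proof -
  let ?\<N> = "finite_quotient_kernels G"
  let ?q = "\<lambda>L. quot_map G L (\<lambda>g. g)"
  \<comment> \<open>Three kinds of constraint: trivial at members of \<open>\<K>\<close>, compatible
    along projections, nontrivial at \<open>N\<close>. Conditions on a single coordinate repeat it
    in both slots.\<close>
  define J where "J = {(K, K, \<lambda>u v. u = K) | K. K \<in> \<K>}
    \<union> {(K, L, \<lambda>u v. ?q L u = v) | K L. K \<in> ?\<N> \<and> L \<in> ?\<N> \<and> K \<subseteq> L}
    \<union> {(N, N, \<lambda>u v. u \<noteq> N)}"
  have nor: "\<And>K. K \<in> ?\<N> \<Longrightarrow> K \<lhd> G"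
    by (rule finite_quotient_kernels_normal)
  have "\<exists>x\<in>PiE ?\<N> (\<lambda>K. carrier (G Mod K)). \<forall>(k, l, R)\<in>J. R (x k) (x l)"
  proof (rule finite_product_compactness)
    show "finite (carrier (G Mod K))" if "K \<in> ?\<N>" for K
      using that by (simp add: finite_quotient_kernels_def)
    show "k \<in> ?\<N> \<and> l \<in> ?\<N>" if "(k, l, R) \<in> J" for k l R
      using that N \<K>(1) by (auto simp: J_def)
    fix F assume F: "finite F" "F \<subseteq> J"
    \<comment> \<open>Asking that every \<open>g\<close> in \<open>K - N\<close> work makes the
      claim stable under shrinking \<open>K\<close>, so the induction merely intersects members of
      \<open>\<K>\<close>.\<close>
    have "\<exists>K\<in>\<K>. \<forall>g\<in>K - N. \<forall>(k, l, R)\<in>F. R (k #> g) (l #> g)"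
      using F
    proof (induction F)
      case empty
      then show ?case using \<K>(2) by auto
    next
      case (insert j F)
      then obtain K where K: "K \<in> \<K>" "\<forall>g\<in>K - N. \<forall>(k, l, R)\<in>F. R (k #> g) (l #> g)"
        by auto
      obtain k l R where j: "j = (k, l, R)" by (cases j)
      have "\<exists>L\<in>\<K>. \<forall>g\<in>L - N. R (k #> g) (l #> g)"
      proof -
        have C: "L \<subseteq> carrier G" if "L \<in> \<K>" for L
          using that \<K>(1) nor normal_imp_subgroup subgroup.subset by blast
        have "j \<in> J" using insert.prems by simp
        then consider L where "L \<in> \<K>" "k = L" "l = L" "R = (\<lambda>u v. u = L)"
          | "k \<in> ?\<N>" "l \<in> ?\<N>" "k \<subseteq> l" "R = (\<lambda>u v. ?q l u = v)"
          | "k = N" "l = N" "R = (\<lambda>u v. u \<noteq> N)"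
          unfolding J_def j by blast
        then show ?thesis
        proof cases
          case 1
          then have "L #> g = L" if "g \<in> L" for g
            using that C[OF 1(1)] normal.coset_eq_self_iff[OF nor] \<K>(1) by blast
          then show ?thesis
            using 1 by auto
        next
          case 2
          then show ?thesis
            using K(1) C[OF K(1)] nor quot_map_id_coset[of k l] by (auto intro!: bexI[of _ K])
        next
          case 3
          then show ?thesis
            using K(1) C[OF K(1)] normal.coset_eq_self_iff[OF nor[OF N]] by (auto intro!: bexI[of _ K])
        qed
      qed
      then obtain L where L: "L \<in> \<K>" "\<forall>g\<in>L - N. R (k #> g) (l #> g)"
        by blast
      have "\<forall>g\<in>K \<inter> L - N. \<forall>(k, l, R)\<in>insert j F. R (k #> g) (l #> g)"
        using K(2) L(2) by (simp add: j)
      then show ?case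
        using Int[OF K(1) L(1)] by (intro bexI)
    qed
    then obtain K where K: "K \<in> \<K>" "\<forall>g\<in>K - N. \<forall>(k, l, R)\<in>F. R (k #> g) (l #> g)"
      by blast
    obtain g where g: "g \<in> K - N"
      using not_sub[OF K(1)] by blast
    then have gC: "g \<in> carrier G"
      using K(1) \<K>(1) nor normal_imp_subgroup subgroup.subset by blast
    have "(\<lambda>M\<in>?\<N>. M #> g) \<in> PiE ?\<N> (\<lambda>K. carrier (G Mod K))"
      using gC by (auto simp: carrier_FactGroup)
    moreover have "\<forall>(k, l, R)\<in>F. R ((\<lambda>M\<in>?\<N>. M #> g) k) ((\<lambda>M\<in>?\<N>. M #> g) l)"
    proof clarify
      fix k l R assume klR: "(k, l, R) \<in> F"
      then have "k \<in> ?\<N>" "l \<in> ?\<N>"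
        using F(2) N \<K>(1) by (auto simp: J_def)
      then show "R ((\<lambda>M\<in>?\<N>. M #> g) k) ((\<lambda>M\<in>?\<N>. M #> g) l)"
        using K(2) g klR by auto
    qed
    ultimately show "\<exists>x\<in>PiE ?\<N> (\<lambda>K. carrier (G Mod K)). \<forall>(k, l, R)\<in>F. R (x k) (x l)"
      by blast
  qed
  then obtain x where x: "x \<in> PiE ?\<N> (\<lambda>K. carrier (G Mod K))"
      "\<forall>(k, l, R)\<in>J. R (x k) (x l)"
    by (elim bexE)
  have xJ: "R (x k) (x l)" if "(k, l, R) \<in> J" for k l R
    using bspec[OF x(2) that] by simp
  have "x \<in> carrier (profinite_completion G)"
    unfolding profinite_completion_def
  proof (rule completionI)
    fix K L assume "K \<in> ?\<N>" "L \<in> ?\<N>" "K \<subseteq> L"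
    then have "(K, L, \<lambda>u v. ?q L u = v) \<in> J"
      by (auto simp: J_def)
    from xJ[OF this] show "?q L (x K) = x L" .
  qed (use x(1) in \<open>auto simp: PiE_def\<close>)
  moreover have "x K = K" if "K \<in> \<K>" for K
  proof -
    have "(K, K, \<lambda>u v. u = K) \<in> J" using that by (auto simp: J_def)
    from xJ[OF this] show ?thesis .
  qed
  moreover have "x N \<noteq> N"
  proof -
    have "(N, N, \<lambda>u v. u \<noteq> N) \<in> J" by (simp add: J_def)
    from xJ[OF this] show ?thesis .
  qed
  ultimately show ?thesis by blast
qed

section \<open>Consequences of surjectivity and injectivity of the profinite map\<close>

lemma (in group_hom) profinite_map_surj_imp_dense:
  assumes surj: "profinite_map G H h ` carrier (profinite_completion G) = carrier (profinite_completion H)"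
    and M: "M \<in> finite_quotient_kernels H" and y: "y \<in> carrier H"
  shows "\<exists>g\<in>carrier G. M #>\<^bsub>H\<^esub> h g = M #>\<^bsub>H\<^esub> y"
proof -
  let ?p = "{g \<in> carrier G. h g \<in> M}"
  \<comment> \<open>The diagonal point of \<open>y\<close> is lifted; the component of the lift at
    the preimage of \<open>M\<close> is the coset of the required \<open>g\<close>.\<close>
  have "(\<lambda>N\<in>finite_quotient_kernels H. N #>\<^bsub>H\<^esub> y) \<in> carrier (profinite_completion H)"
    unfolding profinite_completion_def
    by (rule H.diagonal_in_completion[OF finite_quotient_kernels_normal y])
  from this[folded surj] obtain x where x: "x \<in> carrier (profinite_completion G)"
      "profinite_map G H h x = (\<lambda>N\<in>finite_quotient_kernels H. N #>\<^bsub>H\<^esub> y)"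
    by (elim imageE) simp
  have "x ?p \<in> carrier (G Mod ?p)"
    using x(1) preimage_finite_quotient_kernels[OF M]
    unfolding profinite_completion_def by (rule completion_component)
  then obtain g where g: "g \<in> carrier G" "x ?p = ?p #>\<^bsub>G\<^esub> g"
    by (auto simp: carrier_FactGroup)
  have Mn: "M \<lhd> H"
    using M by (rule finite_quotient_kernels_normal)
  have "M #>\<^bsub>H\<^esub> h g = quot_map H M h (x ?p)"
    unfolding g(2) using preimage_normal[OF Mn] Mn g(1)
    by (intro quot_map_coset[symmetric]) auto
  also have "\<dots> = profinite_map G H h x M"
    using M by (simp add: profinite_map_def completion_map_def)
  also have "\<dots> = M #>\<^bsub>H\<^esub> y"
    using M by (simp add: x(2))
  finally show ?thesis
    using g(1) by blast
qed

text \<open>If no preimage lay inside \<open>N\<close>, the separating point for the family of all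
  preimages would be nontrivial yet in the kernel, since the induced map reads only components at
  preimages.\<close>

lemma (in group_hom) profinite_map_inj_imp_cofinal:
  assumes inj: "inj_on (profinite_map G H h) (carrier (profinite_completion G))"
    and N: "N \<in> finite_quotient_kernels G"
  shows "\<exists>M\<in>finite_quotient_kernels H. {g \<in> carrier G. h g \<in> M} \<subseteq> N"
proof (rule ccontr)
  assume neg: "\<not> ?thesis"
  define p where "p M = {g \<in> carrier G. h g \<in> M}" for M
  let ?\<M> = "finite_quotient_kernels H"
  have pM: "p M \<in> finite_quotient_kernels G" if "M \<in> ?\<M>" for M
    unfolding p_def using that by (rule preimage_finite_quotient_kernels)
  have "carrier (H Mod carrier H) \<subseteq> {carrier H}"
    using H.coset_join2[OF _ H.subgroup_self] by (auto simp: carrier_FactGroup)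
  then have "finite (carrier (H Mod carrier H))"
    by (rule finite_subset) simp
  moreover have "carrier H \<lhd> H"
    by (rule H.normal_invI[OF H.subgroup_self]) simp
  ultimately have "carrier H \<in> ?\<M>"
    by (simp add: finite_quotient_kernels_def)
  then have ne: "p ` ?\<M> \<noteq> {}"
    by blast
  have Int: "K \<inter> L \<in> p ` ?\<M>" if KL: "K \<in> p ` ?\<M>" "L \<in> p ` ?\<M>" for K L
  proof -
    obtain A B where AB: "A \<in> ?\<M>" "B \<in> ?\<M>" "K = p A" "L = p B"
      using KL by blast
    then have "K \<inter> L = p (A \<inter> B)"
      by (auto simp: p_def)
    then show ?thesis
      using H.finite_quotient_kernels_Int[OF AB(1,2)] by blast
  qed
  have "\<exists>x\<in>carrier (profinite_completion G). (\<forall>K\<in>p ` ?\<M>. x K = K) \<and> x N \<noteq> N"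
  proof (rule G.profinite_completion_point_separating[OF N _ ne Int])
    show "p ` ?\<M> \<subseteq> finite_quotient_kernels G"
      using pM by blast
    show "\<not> K \<subseteq> N" if "K \<in> p ` ?\<M>" for K
      using that neg unfolding p_def by blast
  qed
  then obtain x where x: "x \<in> carrier (profinite_completion G)" "x N \<noteq> N"
      "\<forall>K\<in>p ` ?\<M>. x K = K"
    by blast
  let ?one = "\<lambda>N\<in>finite_quotient_kernels G. N"
  have one: "?one \<in> carrier (profinite_completion G)"
  proof -
    have "group (profinite_completion G)"
      unfolding profinite_completion_def
      by (rule G.completion_group[OF finite_quotient_kernels_normal])
    then show ?thesis
      using monoid.one_closed[OF group.is_monoid]
      unfolding profinite_completion_def by (metis one_completion)
  qed
  have "profinite_map G H h x = profinite_map G H h ?one"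
    unfolding profinite_map_def completion_map_def
    using x(3) pM by (intro restrict_ext) (simp add: p_def)
  then have "x = ?one"
    by (rule inj_onD[OF inj _ x(1) one])
  then show False
    using x(2) N by simp
qed

section \<open>Lower central quotients\<close>

lemma (in group_hom) dense_imp_lower_central_dense:
  assumes fg: "finitely_generated_group H"
    and dense: "\<And>M y. M \<in> finite_quotient_kernels H \<Longrightarrow> y \<in> carrier H \<Longrightarrow>
       \<exists>g\<in>carrier G. M #>\<^bsub>H\<^esub> h g = M #>\<^bsub>H\<^esub> y"
    and y: "y \<in> carrier H"
  shows "\<exists>g\<in>carrier G. y \<otimes>\<^bsub>H\<^esub> inv\<^bsub>H\<^esub> h g \<in> lower_central H (Suc c)"
  using y
proof (induction c arbitrary: y)
  case 0
  then show ?case by (auto intro!: bexI[of _ "\<one>\<^bsub>G\<^esub>"])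
next
  case (Suc c)
  define L where "L = lower_central H (Suc (Suc c))"
  \<comment> \<open>The image of \<open>h\<close> times the next lower central term; the aim is
    \<open>K = carrier H\<close>.\<close>
  define K where "K = L <#>\<^bsub>H\<^esub> h ` carrier G"
  have Ln: "L \<lhd> H"
    unfolding L_def by (rule H.lower_central_normal)
  interpret L: normal L H by (rule Ln)
  have "subgroup (h ` carrier G) H"
    by (rule subgroup_img_is_subgroup[OF G.subgroup_self])
  then interpret K: subgroup K H
    unfolding K_def by (rule H.mult_norm_subgroup[OF Ln])
  have LK: "L \<subseteq> K"
  proof
    fix l assume l: "l \<in> L"
    then have "l = l \<otimes>\<^bsub>H\<^esub> h \<one>\<^bsub>G\<^esub>" by simp
    with l show "l \<in> K"
      unfolding K_def set_mult_def using G.one_closed by blast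
  qed
  have hK: "h g \<in> K" if "g \<in> carrier G" for g
  proof -
    have "h g = \<one>\<^bsub>H\<^esub> \<otimes>\<^bsub>H\<^esub> h g" using that by simp
    then show ?thesis
      unfolding K_def set_mult_def using that L.one_closed by blast
  qed
  have Kn: "K \<lhd> H"
  proof (rule H.normal_invI[OF K.subgroup_axioms])
    fix a k assume a: "a \<in> carrier H" and k: "k \<in> K"
    obtain g where g: "g \<in> carrier G" "a \<otimes>\<^bsub>H\<^esub> inv\<^bsub>H\<^esub> h g \<in> lower_central H (Suc c)"
      using Suc.IH[OF a] by blast
    \<comment> \<open>By the induction hypothesis \<open>a\<close> is \<open>w\<close> times
      \<open>h g\<close> with \<open>w\<close> in the previous term. Conjugation by
      \<open>h g\<close> stays inside \<open>K\<close>, and conjugation by \<open>w\<close> changes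
      the result only by a commutator in \<open>L\<close>.\<close>
    define w where "w = a \<otimes>\<^bsub>H\<^esub> inv\<^bsub>H\<^esub> h g"
    define k' where "k' = h g \<otimes>\<^bsub>H\<^esub> k \<otimes>\<^bsub>H\<^esub> inv\<^bsub>H\<^esub> h g"
    have k': "k' \<in> K"
      unfolding k'_def using hK[OF g(1)] k by simp
    have C: "k \<in> carrier H" "k' \<in> carrier H" "w \<in> carrier H" "h g \<in> carrier H"
      using k k' a g(1) by (auto simp: w_def)
    have "w \<otimes>\<^bsub>H\<^esub> k' \<otimes>\<^bsub>H\<^esub> inv\<^bsub>H\<^esub> w \<otimes>\<^bsub>H\<^esub> inv\<^bsub>H\<^esub> k' \<in> L"
      unfolding L_def lower_central.simps using g(2) C(2)
      by (intro generate.incl) (auto simp: w_def)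
    then have "(w \<otimes>\<^bsub>H\<^esub> k' \<otimes>\<^bsub>H\<^esub> inv\<^bsub>H\<^esub> w \<otimes>\<^bsub>H\<^esub> inv\<^bsub>H\<^esub> k') \<otimes>\<^bsub>H\<^esub> k' \<in> K"
      by (rule K.m_closed[OF subsetD[OF LK] k'])
    then have "w \<otimes>\<^bsub>H\<^esub> k' \<otimes>\<^bsub>H\<^esub> inv\<^bsub>H\<^esub> w \<in> K"
      using C by (simp add: H.m_assoc)
    moreover have "w \<otimes>\<^bsub>H\<^esub> k' \<otimes>\<^bsub>H\<^esub> inv\<^bsub>H\<^esub> w = a \<otimes>\<^bsub>H\<^esub> k \<otimes>\<^bsub>H\<^esub> inv\<^bsub>H\<^esub> a"
    proof -
      have "w \<otimes>\<^bsub>H\<^esub> h g = a"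
        using a C by (simp add: w_def H.m_assoc)
      moreover have "w \<otimes>\<^bsub>H\<^esub> k' \<otimes>\<^bsub>H\<^esub> inv\<^bsub>H\<^esub> w = (w \<otimes>\<^bsub>H\<^esub> h g) \<otimes>\<^bsub>H\<^esub> k \<otimes>\<^bsub>H\<^esub> inv\<^bsub>H\<^esub> (w \<otimes>\<^bsub>H\<^esub> h g)"
        using C by (simp add: k'_def H.m_assoc H.inv_mult_group)
      ultimately show ?thesis by simp
    qed
    ultimately show "a \<otimes>\<^bsub>H\<^esub> k \<otimes>\<^bsub>H\<^esub> inv\<^bsub>H\<^esub> a \<in> K"
      by simp
  qed
  interpret K: normal K H by (rule Kn)
  have "nilpotent_group (H Mod K)"
    unfolding K.nilpotent_FactGroup_iff
    using LK unfolding L_def by (intro exI[of _ "Suc (Suc c)"]) simp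
  then have Knil: "K \<in> nilpotent_quotient_kernels H"
    using Kn by (simp add: nilpotent_quotient_kernels_def)
  have "y \<in> K"
  proof (rule ccontr)
    assume "y \<notin> K"
    then obtain N where N: "N \<in> finite_quotient_kernels H" "K \<subseteq> N" "y \<notin> N"
      using H.nilpotent_quotient_residually_finite[OF fg Knil Suc.prems] by blast
    interpret N: normal N H
      using N(1) by (rule finite_quotient_kernels_normal)
    obtain g where g: "g \<in> carrier G" "N #>\<^bsub>H\<^esub> h g = N #>\<^bsub>H\<^esub> y"
      using dense[OF N(1) Suc.prems] by blast
    \<comment> \<open>The image of \<open>h\<close> lies in \<open>K\<close> and so in
      \<open>N\<close>, while density puts some \<open>h g\<close> in the coset of \<open>y\<close>;
      this contradicts the choice of \<open>N\<close>.\<close>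
    have "h g \<in> N"
      using hK[OF g(1)] N(2) by blast
    then have "N #>\<^bsub>H\<^esub> y = N"
      using g N.coset_eq_self_iff[of "h g"] by simp
    then show False
      using N(3) N.coset_eq_self_iff[OF Suc.prems] by simp
  qed
  then obtain l g where lg: "l \<in> L" "g \<in> carrier G" "y = l \<otimes>\<^bsub>H\<^esub> h g"
    by (auto simp: K_def set_mult_def)
  then have "y \<otimes>\<^bsub>H\<^esub> inv\<^bsub>H\<^esub> h g = l"
    using L.mem_carrier by (simp add: H.m_assoc)
  with lg show ?case
    unfolding L_def by (intro bexI[of _ g]) simp_all
qed

lemma (in group) lower_central_nilpotent_quotient_kernel:
  "lower_central G (Suc c) \<in> nilpotent_quotient_kernels G"
proof -
  interpret L: normal "lower_central G (Suc c)" G by (rule lower_central_normal)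
  have "nilpotent_group (G Mod lower_central G (Suc c))"
    unfolding L.nilpotent_FactGroup_iff by (intro exI[of _ "Suc c"]) simp
  then show ?thesis
    using lower_central_normal by (simp add: nilpotent_quotient_kernels_def)
qed

lemma (in group_hom) preimage_lower_central:
  assumes fg: "finitely_generated_group G"
    and dense: "\<And>M y. M \<in> finite_quotient_kernels H \<Longrightarrow> y \<in> carrier H \<Longrightarrow>
       \<exists>g\<in>carrier G. M #>\<^bsub>H\<^esub> h g = M #>\<^bsub>H\<^esub> y"
    and cofinal: "\<And>N. N \<in> finite_quotient_kernels G \<Longrightarrow>
       \<exists>M\<in>finite_quotient_kernels H. {g \<in> carrier G. h g \<in> M} \<subseteq> N"
  shows "{g \<in> carrier G. h g \<in> lower_central H (Suc c)} = lower_central G (Suc c)"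
proof (rule equalityI)
  have "lower_central G (Suc c) \<subseteq> carrier G"
    using G.lower_central_subgroup by (rule subgroup.subset)
  then show "lower_central G (Suc c) \<subseteq> {g \<in> carrier G. h g \<in> lower_central H (Suc c)}"
    using lower_central_image[of "Suc c"] by blast
  show "{g \<in> carrier G. h g \<in> lower_central H (Suc c)} \<subseteq> lower_central G (Suc c)"
  proof (rule subsetI, rule ccontr)
    fix g assume "g \<in> {g \<in> carrier G. h g \<in> lower_central H (Suc c)}"
      and ng: "g \<notin> lower_central G (Suc c)"
    then have g: "g \<in> carrier G" "h g \<in> lower_central H (Suc c)"
      by auto
    obtain N where N: "N \<in> finite_quotient_kernels G" "lower_central G (Suc c) \<subseteq> N" "g \<notin> N"
      using G.nilpotent_quotient_residually_finite[OF fg G.lower_central_nilpotent_quotient_kernel g(1) ng]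
      by blast
    obtain M where M: "M \<in> finite_quotient_kernels H" "{g \<in> carrier G. h g \<in> M} \<subseteq> N"
      using cofinal[OF N(1)] by blast
    interpret N: normal N G
      using N(1) by (rule finite_quotient_kernels_normal)
    interpret M: normal M H
      using M(1) by (rule finite_quotient_kernels_normal)
    interpret q: group_hom H "H Mod M" "\<lambda>a. M #>\<^bsub>H\<^esub> a" by (rule M.coset_hom)
    have "(\<lambda>a. M #>\<^bsub>H\<^esub> a) \<circ> h \<in> hom G (H Mod M)"
      using homh q.homh by (rule Group.hom_compose)
    then interpret f: group_hom G "H Mod M" "(\<lambda>a. M #>\<^bsub>H\<^esub> a) \<circ> h"
      by unfold_locales
    \<comment> \<open>Since \<open>G\<close> maps onto \<open>H Mod M\<close>, its lower central
      term maps onto that of the quotient. Hence \<open>h g\<close> agrees modulo \<open>M\<close>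
      with some \<open>h p\<close>, where \<open>p\<close> lies in the lower central term of
      \<open>G\<close> and so in \<open>N\<close>.\<close>
    have "((\<lambda>a. M #>\<^bsub>H\<^esub> a) \<circ> h) ` carrier G = carrier (H Mod M)"
    proof
      show "carrier (H Mod M) \<subseteq> ((\<lambda>a. M #>\<^bsub>H\<^esub> a) \<circ> h) ` carrier G"
        using dense[OF M(1)] by (force simp: carrier_FactGroup)
    qed auto
    then have "((\<lambda>a. M #>\<^bsub>H\<^esub> a) \<circ> h) ` lower_central G (Suc c) = lower_central (H Mod M) (Suc c)"
      by (rule f.lower_central_surj_image)
    also have "\<dots> = (\<lambda>a. M #>\<^bsub>H\<^esub> a) ` lower_central H (Suc c)"
      by (rule M.lower_central_FactGroup)
    finally have "M #>\<^bsub>H\<^esub> h g \<in> ((\<lambda>a. M #>\<^bsub>H\<^esub> a) \<circ> h) ` lower_central G (Suc c)"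
      using g(2) by blast
    then obtain p where p: "p \<in> lower_central G (Suc c)" "M #>\<^bsub>H\<^esub> h g = M #>\<^bsub>H\<^esub> h p"
      by auto
    have pN: "p \<in> N" "p \<in> carrier G"
      using p(1) N(2) N.mem_carrier by auto
    have "h g \<otimes>\<^bsub>H\<^esub> inv\<^bsub>H\<^esub> h p \<in> M"
      using p(2) M.coset_eq_iff g(1) pN(2) by simp
    then have "h (g \<otimes>\<^bsub>G\<^esub> inv\<^bsub>G\<^esub> p) \<in> M"
      using g(1) pN(2) by simp
    then have "g \<otimes>\<^bsub>G\<^esub> inv\<^bsub>G\<^esub> p \<in> N"
      using M(2) g(1) pN(2) by auto
    then have "(g \<otimes>\<^bsub>G\<^esub> inv\<^bsub>G\<^esub> p) \<otimes>\<^bsub>G\<^esub> p \<in> N"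
      using pN(1) by (rule N.m_closed)
    then show False
      using N(3) g(1) pN(2) by (simp add: G.m_assoc)
  qed
qed

text \<open>Injective because \<open>N\<close> is the full preimage of \<open>M\<close>; surjective
  because every element of \<open>H\<close> is congruent modulo \<open>M\<close> to a value of
  \<open>h\<close>.\<close>

lemma (in group_hom) quot_map_iso:
  assumes M: "M \<lhd> H" and N: "{g \<in> carrier G. h g \<in> M} = N"
    and dense: "\<And>y. y \<in> carrier H \<Longrightarrow> \<exists>g\<in>carrier G. y \<otimes>\<^bsub>H\<^esub> inv\<^bsub>H\<^esub> h g \<in> M"
  shows "quot_map H M h \<in> iso (G Mod N) (H Mod M)"
proof -
  interpret M: normal M H by fact
  have Nn: "N \<lhd> G" and sub: "h ` N \<subseteq> M"
    using preimage_normal[OF M] N by auto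
  have "carrier (H Mod M) \<subseteq> quot_map H M h ` carrier (G Mod N)"
  proof
    fix Y assume "Y \<in> carrier (H Mod M)"
    then obtain y where y: "y \<in> carrier H" "Y = M #>\<^bsub>H\<^esub> y"
      by (auto simp: carrier_FactGroup)
    obtain g where g: "g \<in> carrier G" "y \<otimes>\<^bsub>H\<^esub> inv\<^bsub>H\<^esub> h g \<in> M"
      using dense[OF y(1)] by blast
    then have "Y = quot_map H M h (N #>\<^bsub>G\<^esub> g)"
      using y M.coset_eq_iff[of y "h g"] quot_map_coset[OF Nn M sub g(1)] by simp
    then show "Y \<in> quot_map H M h ` carrier (G Mod N)"
      using g(1) by (auto simp: carrier_FactGroup)
  qed
  moreover have hom: "quot_map H M h \<in> hom (G Mod N) (H Mod M)"
    by (rule quot_map_hom[OF Nn M sub])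
  then have "quot_map H M h ` carrier (G Mod N) \<subseteq> carrier (H Mod M)"
    by (auto simp: hom_def)
  ultimately have "bij_betw (quot_map H M h) (carrier (G Mod N)) (carrier (H Mod M))"
    using quot_map_preimage_inj[OF M] unfolding N bij_betw_def by blast
  with hom show ?thesis
    by (simp add: iso_def)
qed

text \<open>A commutator is \<open>x\<close> times a conjugate of its inverse, so it stays in any
  normal subgroup containing \<open>x\<close>.\<close>

lemma (in group) lower_central_Suc_antimono:
  assumes "c \<le> d"
  shows "lower_central G (Suc d) \<subseteq> lower_central G (Suc c)"
proof (rule lift_Suc_antimono_le[OF _ assms])
  fix n
  interpret N: normal "lower_central G (Suc n)" G by (rule lower_central_normal)
  have "{x \<otimes> y \<otimes> inv x \<otimes> inv y | x y. x \<in> lower_central G (Suc n) \<and> y \<in> carrier G}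
      \<subseteq> lower_central G (Suc n)"
  proof clarify
    fix x y assume xy: "x \<in> lower_central G (Suc n)" "y \<in> carrier G"
    have "y \<otimes> inv x \<otimes> inv y \<in> lower_central G (Suc n)"
      using xy by (intro N.inv_op_closed2 N.m_inv_closed)
    from N.m_closed[OF xy(1) this]
    show "x \<otimes> y \<otimes> inv x \<otimes> inv y \<in> lower_central G (Suc n)"
      using xy N.mem_carrier[OF xy(1)] by (simp only: m_assoc m_closed inv_closed)
  qed
  then show "lower_central G (Suc (Suc n)) \<subseteq> lower_central G (Suc n)"
    unfolding lower_central.simps(3) by (rule generate_subgroup_incl[OF _ N.subgroup_axioms])
qed

text \<open>Cofinality of the lower central series: a point of the pronilpotent completion is
  determined by its components at these terms.\<close>

lemma (in group) nilpotent_quotient_kernelsE: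
  assumes "N \<in> nilpotent_quotient_kernels G"
  obtains c where "lower_central G (Suc c) \<subseteq> N"
proof -
  have "N \<lhd> G" "nilpotent_group (G Mod N)"
    using assms by (auto simp: nilpotent_quotient_kernels_def)
  then obtain n where "n \<ge> 1" "lower_central G n \<subseteq> N"
    using normal.nilpotent_FactGroup_iff by blast
  with that[of "n - 1"] show thesis by simp
qed

section \<open>Pronilpotent completions\<close>

lemma (in group_hom) pronilpotent_map_iso:
  assumes pre: "\<And>c. {g \<in> carrier G. h g \<in> lower_central H (Suc c)} = lower_central G (Suc c)"
    and dense: "\<And>c y. y \<in> carrier H \<Longrightarrow>
      \<exists>g\<in>carrier G. y \<otimes>\<^bsub>H\<^esub> inv\<^bsub>H\<^esub> h g \<in> lower_central H (Suc c)"
  shows "pronilpotent_map G H h \<in> iso (pronilpotent_completion G) (pronilpotent_completion H)"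
proof -
  let ?\<N> = "nilpotent_quotient_kernels G" and ?\<M> = "nilpotent_quotient_kernels H"
  let ?\<gamma> = "\<lambda>c. lower_central G (Suc c)" and ?\<delta> = "\<lambda>c. lower_central H (Suc c)"
  have Gn: "\<And>N. N \<in> ?\<N> \<Longrightarrow> N \<lhd> G" and Hn: "\<And>M. M \<in> ?\<M> \<Longrightarrow> M \<lhd> H"
    by (rule nilpotent_quotient_kernels_normal, assumption)+
  have \<gamma>: "\<And>c. ?\<gamma> c \<in> ?\<N>" and \<delta>: "\<And>c. ?\<delta> c \<in> ?\<M>"
    by (rule G.lower_central_nilpotent_quotient_kernel H.lower_central_nilpotent_quotient_kernel)+
  have map: "pronilpotent_map G H h x M = quot_map H M h (x {g \<in> carrier G. h g \<in> M})"
    if "M \<in> ?\<M>" for x M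
    using that by (simp add: pronilpotent_map_def completion_map_def)
  have map_coset: "quot_map H M h ({g \<in> carrier G. h g \<in> M} #>\<^bsub>G\<^esub> g) = M #>\<^bsub>H\<^esub> h g"
    if "M \<in> ?\<M>" "g \<in> carrier G" for M g
    using preimage_normal[OF Hn[OF that(1)]] Hn[OF that(1)] that(2)
    by (intro quot_map_coset) auto
  interpret m: group_hom "pronilpotent_completion G" "pronilpotent_completion H"
    "pronilpotent_map G H h"
    unfolding pronilpotent_completion_def
    by (intro group_hom.intro group_hom_axioms.intro G.completion_group H.completion_group Gn Hn
        pronilpotent_map_hom[unfolded pronilpotent_completion_def])
  \<comment> \<open>Injectivity is checked on the kernel. Below each \<open>N\<close> lies a lower
    central term, at which \<open>x\<close> is trivial because \<open>pre\<close> makes this term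
    the full preimage of its counterpart in \<open>H\<close>.\<close>
  have "x = \<one>\<^bsub>pronilpotent_completion G\<^esub>"
    if x: "x \<in> carrier (pronilpotent_completion G)"
      and eq: "pronilpotent_map G H h x = \<one>\<^bsub>pronilpotent_completion H\<^esub>" for x
  proof -
    have xC: "x \<in> carrier (completion G ?\<N>)"
      using x by (simp add: pronilpotent_completion_def)
    have "x N = N" if N: "N \<in> ?\<N>" for N
    proof -
      obtain c where c: "?\<gamma> c \<subseteq> N"
        using N by (rule G.nilpotent_quotient_kernelsE)
      obtain g where g: "g \<in> carrier G" "x (?\<gamma> c) = ?\<gamma> c #>\<^bsub>G\<^esub> g"
        using completion_component[OF xC \<gamma>[of c]] by (auto simp: carrier_FactGroup)
      have "?\<delta> c #>\<^bsub>H\<^esub> h g = quot_map H (?\<delta> c) h (x (?\<gamma> c))"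
        using map_coset[OF \<delta> g(1), of c] unfolding pre g(2) by (rule sym)
      also have "\<dots> = pronilpotent_map G H h x (?\<delta> c)"
        using map[OF \<delta>, of x c] unfolding pre by (rule sym)
      also have "\<dots> = ?\<delta> c"
        unfolding eq pronilpotent_completion_def one_completion using \<delta>[of c] by simp
      finally have "h g \<in> ?\<delta> c"
        using normal.coset_eq_self_iff[OF H.lower_central_normal hom_closed[OF g(1)]] by blast
      then have "g \<in> ?\<gamma> c"
        using g(1) pre[of c] by blast
      then have gN: "g \<in> N"
        using c by blast
      have "x N = quot_map G N (\<lambda>g. g) (x (?\<gamma> c))"
        by (rule completion_compatible[OF xC \<gamma> N c, symmetric])
      also have "\<dots> = N #>\<^bsub>G\<^esub> g"
        unfolding g(2) by (rule G.quot_map_id_coset[OF Gn[OF \<gamma>] Gn[OF N] c g(1)])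
      also have "\<dots> = N"
        using normal.coset_eq_self_iff[OF Gn[OF N] g(1)] gN by blast
      finally show ?thesis .
    qed
    then show ?thesis
      unfolding pronilpotent_completion_def one_completion
      by (intro extensionalityI[OF completion_extensional[OF xC]]) auto
  qed
  moreover have "carrier (pronilpotent_completion H)
      \<subseteq> pronilpotent_map G H h ` carrier (pronilpotent_completion G)"
  proof
    fix y assume "y \<in> carrier (pronilpotent_completion H)"
    then have y: "y \<in> carrier (completion H ?\<M>)"
      by (simp add: pronilpotent_completion_def)
    have "\<exists>g. g \<in> carrier G \<and> y (?\<delta> c) = ?\<delta> c #>\<^bsub>H\<^esub> h g" for c
    proof -
      obtain z where z: "z \<in> carrier H" "y (?\<delta> c) = ?\<delta> c #>\<^bsub>H\<^esub> z"
        using completion_component[OF y \<delta>[of c]] by (auto simp: carrier_FactGroup)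
      obtain g where g: "g \<in> carrier G" "z \<otimes>\<^bsub>H\<^esub> inv\<^bsub>H\<^esub> h g \<in> ?\<delta> c"
        using dense[OF z(1)] by blast
      have "?\<delta> c #>\<^bsub>H\<^esub> z = ?\<delta> c #>\<^bsub>H\<^esub> h g"
        using normal.coset_eq_iff[OF H.lower_central_normal z(1) hom_closed[OF g(1)]] g(2) by blast
      with g(1) z(2) show ?thesis by auto
    qed
    then obtain p where p: "\<And>c. p c \<in> carrier G" "\<And>c. y (?\<delta> c) = ?\<delta> c #>\<^bsub>H\<^esub> h (p c)"
      by metis
    have yM: "y M = M #>\<^bsub>H\<^esub> h (p c)" if M: "M \<in> ?\<M>" and c: "?\<delta> c \<subseteq> M" for M c
    proof -
      have "y M = quot_map H M (\<lambda>g. g) (y (?\<delta> c))"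
        by (rule completion_compatible[OF y \<delta> M c, symmetric])
      also have "\<dots> = M #>\<^bsub>H\<^esub> h (p c)"
        unfolding p(2) by (rule H.quot_map_id_coset[OF Hn[OF \<delta>] Hn[OF M] c hom_closed[OF p(1)]])
      finally show ?thesis .
    qed
    \<comment> \<open>The chosen \<open>p c\<close> need not be coherent in \<open>G\<close>, but
      compatibility of \<open>y\<close> makes \<open>p c\<close> and \<open>p d\<close> agree modulo
      the \<open>c\<close>-th term, again by \<open>pre\<close>.\<close>
    have le: "N #>\<^bsub>G\<^esub> p c = N #>\<^bsub>G\<^esub> p d" if N: "N \<in> ?\<N>" "?\<gamma> c \<subseteq> N" and "c \<le> d" for N c d
    proof -
      have "?\<delta> c #>\<^bsub>H\<^esub> h (p c) = ?\<delta> c #>\<^bsub>H\<^esub> h (p d)"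
        using yM[OF \<delta> order_refl] yM[OF \<delta> H.lower_central_Suc_antimono[OF \<open>c \<le> d\<close>]] by simp
      then have "h (p c) \<otimes>\<^bsub>H\<^esub> inv\<^bsub>H\<^esub> h (p d) \<in> ?\<delta> c"
        using normal.coset_eq_iff[OF H.lower_central_normal hom_closed[OF p(1)] hom_closed[OF p(1)]]
        by blast
      then have "h (p c \<otimes>\<^bsub>G\<^esub> inv\<^bsub>G\<^esub> p d) \<in> ?\<delta> c"
        using p(1) by simp
      then have "p c \<otimes>\<^bsub>G\<^esub> inv\<^bsub>G\<^esub> p d \<in> ?\<gamma> c"
        unfolding pre[symmetric] using p(1) by simp
      then show ?thesis
        using normal.coset_eq_iff[OF Gn[OF N(1)] p(1) p(1)] N(2) by blast
    qed
    define k where "k N = (SOME c. ?\<gamma> c \<subseteq> N)" for N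
    have k: "?\<gamma> (k N) \<subseteq> N" if N: "N \<in> ?\<N>" for N
    proof -
      obtain c where "?\<gamma> c \<subseteq> N"
        using N by (rule G.nilpotent_quotient_kernelsE)
      then show ?thesis
        unfolding k_def by (rule someI)
    qed
    define x where "x = (\<lambda>N\<in>?\<N>. N #>\<^bsub>G\<^esub> p (k N))"
    \<comment> \<open>Hence the coset defining \<open>x N\<close> does not depend on the level
      selected by \<open>k\<close>; this is what makes \<open>x\<close> compatible.\<close>
    have xN: "x N = N #>\<^bsub>G\<^esub> p c" if N: "N \<in> ?\<N>" and c: "?\<gamma> c \<subseteq> N" for N c
      using le[OF N c, of "k N"] le[OF N k[OF N], of c] N linear[of c "k N"]
      by (auto simp: x_def)
    have "x \<in> carrier (completion G ?\<N>)"
    proof (rule completionI)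
      fix K L assume KL: "K \<in> ?\<N>" "L \<in> ?\<N>" "K \<subseteq> L"
      have "quot_map G L (\<lambda>g. g) (x K) = L #>\<^bsub>G\<^esub> p (k K)"
        unfolding xN[OF KL(1) k[OF KL(1)]]
        by (rule G.quot_map_id_coset[OF Gn[OF KL(1)] Gn[OF KL(2)] KL(3) p(1)])
      also have "\<dots> = x L"
        using xN[OF KL(2) order_trans[OF k[OF KL(1)] KL(3)]] by simp
      finally show "quot_map G L (\<lambda>g. g) (x K) = x L" .
    qed (use p(1) in \<open>auto simp: x_def carrier_FactGroup\<close>)
    moreover have "pronilpotent_map G H h x = y"
    proof (rule extensionalityI)
      show "pronilpotent_map G H h x \<in> extensional ?\<M>"
        by (simp add: pronilpotent_map_def completion_map_def)
      show "y \<in> extensional ?\<M>"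
        by (rule completion_extensional[OF y])
      fix M assume M: "M \<in> ?\<M>"
      obtain c where c: "?\<delta> c \<subseteq> M"
        using M by (rule H.nilpotent_quotient_kernelsE)
      have sub: "?\<gamma> c \<subseteq> {g \<in> carrier G. h g \<in> M}"
        using c unfolding pre[symmetric] by blast
      have "pronilpotent_map G H h x M = M #>\<^bsub>H\<^esub> h (p c)"
        unfolding map[OF M] xN[OF preimage_nilpotent_quotient_kernels[OF M] sub]
        by (rule map_coset[OF M p(1)])
      also have "\<dots> = y M"
        by (rule yM[OF M c, symmetric])
      finally show "pronilpotent_map G H h x M = y M" .
    qed
    ultimately show "y \<in> pronilpotent_map G H h ` carrier (pronilpotent_completion G)"
      unfolding pronilpotent_completion_def by blast
  qed
  ultimately show ?thesis
    unfolding m.iso_iff by blast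
qed

section \<open>Application to the inclusion of a Grothendieck pair\<close>

theorem proposition3p4:
  fixes \<Gamma> :: "('a, 'b) monoid_scheme" and P :: "'a set"
  assumes "group \<Gamma>" and "subgroup P \<Gamma>"
    and "finitely_generated_group \<Gamma>" and "finitely_generated_group (\<Gamma>\<lparr>carrier := P\<rparr>)"
    and "residually_finite \<Gamma>" and "residually_finite (\<Gamma>\<lparr>carrier := P\<rparr>)"
    and "grothendieck_pair \<Gamma> P"
  shows "(\<forall>c\<ge>1. quot_map \<Gamma> (lower_central \<Gamma> c) (\<lambda>x. x)
            \<in> iso (\<Gamma>\<lparr>carrier := P\<rparr> Mod lower_central (\<Gamma>\<lparr>carrier := P\<rparr>) c)
                  (\<Gamma> Mod lower_central \<Gamma> c))
       \<and> pronilpotent_map (\<Gamma>\<lparr>carrier := P\<rparr>) \<Gamma> (\<lambda>x. x)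
            \<in> iso (pronilpotent_completion (\<Gamma>\<lparr>carrier := P\<rparr>)) (pronilpotent_completion \<Gamma>)
       \<and> (residually_nilpotent (\<Gamma>\<lparr>carrier := P\<rparr>) \<and> residually_nilpotent \<Gamma>
            \<longrightarrow> same_nilpotent_genus (\<Gamma>\<lparr>carrier := P\<rparr>) \<Gamma>)"
proof -
  let ?P = "\<Gamma>\<lparr>carrier := P\<rparr>"
  interpret \<Gamma>: group \<Gamma> by fact
  interpret P: subgroup P \<Gamma> by fact
  interpret u: group_hom ?P \<Gamma> "\<lambda>x. x"
    using P.subset by (intro group_hom.intro group_hom_axioms.intro \<Gamma>.subgroup_imp_group assms)
      (auto simp: hom_def)
  have "profinite_map ?P \<Gamma> (\<lambda>x. x) \<in> iso (profinite_completion ?P) (profinite_completion \<Gamma>)"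
    using assms(7) by (simp add: grothendieck_pair_def)
  then have inj: "inj_on (profinite_map ?P \<Gamma> (\<lambda>x. x)) (carrier (profinite_completion ?P))"
    and surj: "profinite_map ?P \<Gamma> (\<lambda>x. x) ` carrier (profinite_completion ?P)
      = carrier (profinite_completion \<Gamma>)"
    by (auto simp: iso_def bij_betw_def)
  \<comment> \<open>Surjectivity alone, with \<open>\<Gamma>\<close> finitely generated, gives
    density modulo lower central terms; injectivity enters through cofinality in \<open>pre\<close>,
    where \<open>P\<close> must be finitely generated.\<close>
  note dense = u.profinite_map_surj_imp_dense[OF surj]
  note dense_lc = u.dense_imp_lower_central_dense[OF assms(3) dense]
  note pre = u.preimage_lower_central[OF assms(4) dense u.profinite_map_inj_imp_cofinal[OF inj]]
  have iso: "quot_map \<Gamma> (lower_central \<Gamma> c) (\<lambda>x. x)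
      \<in> iso (?P Mod lower_central ?P c) (\<Gamma> Mod lower_central \<Gamma> c)" if "c \<ge> 1" for c
  proof -
    \<comment> \<open>The auxiliary results count from \<open>Suc d\<close>, which matches the range
      \<open>c \<ge> 1\<close>.\<close>
    obtain d where d: "c = Suc d"
      using \<open>c \<ge> 1\<close> by (cases c) auto
    show ?thesis
      unfolding d by (rule u.quot_map_iso[OF \<Gamma>.lower_central_normal pre dense_lc])
  qed
  moreover have "pronilpotent_map ?P \<Gamma> (\<lambda>x. x)
      \<in> iso (pronilpotent_completion ?P) (pronilpotent_completion \<Gamma>)"
    by (rule u.pronilpotent_map_iso[OF pre dense_lc])
  moreover have "same_nilpotent_genus ?P \<Gamma>"
    if "residually_nilpotent ?P" "residually_nilpotent \<Gamma>"
    using that iso unfolding same_nilpotent_genus_def is_iso_def by blast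
  ultimately show ?thesis
    by blast
qed

end
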